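(* Let $g:\mathbb{R}^d\to\mathbb{R}$ be continuously differentiable and non-negative with $\|\nabla g(\theta)-\nabla g(\theta')\|\le L\|\theta-\theta'\|$ for all $\theta,\theta'\in\mathbb{R}^d$. Let $\{\theta_n\}_{n\ge1}$ be generated by AdaGrad-Norm, and suppose that for all $n\ge 1$: (i) $\mathbb{E}[\nabla g(\theta_n,\xi_n)\mid\mathscr{F}_{n-1}]=\nabla g(\theta_n)$; (ii) $\mathbb{E}[\|\nabla g(\theta_n,\xi_n)\|^2\mid\mathscr{F}_{n-1}]\le\sigma_0\|\nabla g(\theta_n)\|^2+\sigma_1$ for some constants $\sigma_0,\sigma_1\ge0$. Then for any initial point $\theta_1\in\mathbb{R}^d$, any $S_0>0$ and any $\delta\in(0,1)$, with probability at least $1-\delta$, $$\frac1T\sum_{n=1}^T\|\nabla g(\theta_n)\|^2\le\mathcal{O}\Big(\frac1\delta\cdot\frac{\ln T}{\sqrt T}\Big)\quad\text{and}\quad \min_{1\le n\le T}\|\nabla g(\theta_n)\|^2\le\mathcal{O}\Big(\frac1\delta\cdot\frac{\ln T}{\sqrt T}\Big).$$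
   Context: AdaGrad-Norm: given an initial point $\theta_1\in\mathbb{R}^d$ and constants $S_0>0$, $\alpha_0>0$, for $n\ge1$ $$S_n=S_{n-1}+\|\nabla g(\theta_n,\xi_n)\|^2,\qquad \theta_{n+1}=\theta_n-\frac{\alpha_0}{\sqrt{S_n}}\nabla g(\theta_n,\xi_n).$$ Here $\{\xi_n\}_{n\ge1}$ is a sequence of independent random variables and $\nabla g(\theta_n,\xi_n)\in\mathbb{R}^d$ is the random vector (stochastic gradient) returned by a stochastic first-order oracle at $\theta_n$ with noise $\xi_n$. The filtration is $\mathscr{F}_n=\sigma\{\theta_1,\xi_1,\dots,\xi_n\}$ for $n\ge1$ and $\mathscr{F}_0=\{\emptyset,\Omega\}$. The probability statement is for each (large) $T$; the constant hidden in $\mathcal{O}(\cdot)$ (as $T\to\infty$) is independent of $T$ and of $\delta$. *)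

theory Defs
  imports "HOL-Probability.Probability"
begin

text \<open>
  Conditional expectation of a random vector, taken coordinatewise, since the library's
  \<^const>\<open>real_cond_exp\<close> covers real-valued functions only.
\<close>

definition vec_cond_exp ::
  "'w measure \<Rightarrow> 'w measure \<Rightarrow> ('w \<Rightarrow> 'a::euclidean_space) \<Rightarrow> 'w \<Rightarrow> 'a" where
  "vec_cond_exp M F X \<omega> = (\<Sum>b\<in>Basis. real_cond_exp M F (\<lambda>\<omega>'. X \<omega>' \<bullet> b) \<omega> *\<^sub>R b)"

text \<open>
  The filtration generated by the initial point and the noise. At \<open>n = 0\<close> it is the trivial
  sigma-algebra. As elsewhere in the library, a sub-sigma-algebra is represented by a
  \<open>measure\<close> whose measure component is irrelevant.
\<close>

definition noise_filtration ::
  "'w measure \<Rightarrow> 'x measure \<Rightarrow> ('w \<Rightarrow> 'a::topological_space) \<Rightarrow> (nat \<Rightarrow> 'w \<Rightarrow> 'x) \<Rightarrow> nat \<Rightarrow> 'w measure"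
where
  "noise_filtration M N X \<xi> n =
     (if n = 0 then sigma (space M) {}
      else sigma (space M)
        ({X -` A \<inter> space M | A. A \<in> sets borel} \<union>
         (\<Union>i\<in>{1..n}. {\<xi> i -` A \<inter> space M | A. A \<in> sets N})))"

text \<open>
  \<open>G\<close> is the stochastic first-order gradient source, \<open>G x z\<close> being the stochastic gradient at the point
  \<open>x\<close> with noise \<open>z\<close>. The value \<open>\<theta> 0\<close> is unconstrained: the iterates are indexed from 1.
\<close>

definition adagrad_norm ::
  "'w measure \<Rightarrow> ('a::euclidean_space \<Rightarrow> 'x \<Rightarrow> 'a) \<Rightarrow> (nat \<Rightarrow> 'w \<Rightarrow> 'x) \<Rightarrow> real \<Rightarrow> real \<Rightarrow> 'a \<Rightarrow>
   (nat \<Rightarrow> 'w \<Rightarrow> 'a) \<Rightarrow> (nat \<Rightarrow> 'w \<Rightarrow> real) \<Rightarrow> bool" where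
  "adagrad_norm M G \<xi> \<alpha>\<^sub>0 S\<^sub>0 \<theta>\<^sub>1 \<theta> S \<longleftrightarrow>
     (\<forall>\<omega>\<in>space M.
        \<theta> 1 \<omega> = \<theta>\<^sub>1 \<and> S 0 \<omega> = S\<^sub>0 \<and>
        (\<forall>n\<ge>1.
           S n \<omega> = S (n - 1) \<omega> + (norm (G (\<theta> n \<omega>) (\<xi> n \<omega>)))\<^sup>2 \<and>
           \<theta> (n + 1) \<omega> = \<theta> n \<omega> - (\<alpha>\<^sub>0 / sqrt (S n \<omega>)) *\<^sub>R G (\<theta> n \<omega>) (\<xi> n \<omega>)))"

end

theory Submission
  imports Defs "HOL-Real_Asymp.Real_Asymp"
begin

text \<open>
  Write \<open>v\<^sub>n = \<nabla>g(\<theta>\<^sub>n)\<close>, \<open>y\<^sub>n\<close> for the stochastic gradient and \<open>\<zeta>\<^sub>n = \<parallel>v\<^sub>n\<parallel>\<^sup>2 / sqrt S\<^sub>n\<^sub>-\<^sub>1\<close>.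
  Since \<open>S\<close> is increasing, \<open>\<Sum>\<parallel>v\<^sub>n\<parallel>\<^sup>2 \<le> sqrt S\<^sub>T \<cdot> \<Sum>\<zeta>\<^sub>n\<close>, so a bound of order \<open>ln T\<close> for \<open>\<Sum>\<zeta>\<^sub>n\<close> and
  one of order \<open>T\<close> for \<open>S\<^sub>T\<close> give the rate \<open>sqrt T ln T\<close>. A failure probability linear in \<open>\<delta>\<close> needs
  the rate for the expectation of the product. As only the first moment of \<open>S\<^sub>T\<close> is under control,
  Cauchy--Schwarz asks for the \<^emph>\<open>second\<close> moment of \<open>\<Sum>\<zeta>\<^sub>n\<close>, which is the heart of the proof.

  The normalised energies \<open>\<Gamma>\<^sub>n = \<parallel>y\<^sub>n\<parallel>\<^sup>2 / S\<^sub>n\<close> have \<open>\<Sum>\<Gamma>\<^sub>n \<le> ln (S\<^sub>T / S\<^sub>0)\<close> on every path. The process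
  \<open>g(\<theta>\<^sub>n) + c \<zeta>\<^sub>n + (\<alpha>\<^sub>0/4) \<Sum>\<^sub>k\<^sub><\<^sub>n \<zeta>\<^sub>k + B - K \<Sum>\<^sub>k\<^sub><\<^sub>n \<Gamma>\<^sub>k\<close> is therefore nonnegative as long as \<open>S\<close> stays
  below a threshold \<open>R\<close>, for a suitable \<open>B\<close> of order \<open>ln R\<close>. Its drift is negative, by a
  multiple of \<open>\<zeta>\<^sub>n\<close> and of \<open>\<Gamma>\<^sub>n\<close>, while the square of its increment is, up to a decrease that
  \<open>square_increment_bound\<close> pays for, at most its current value times a combination of \<open>\<Gamma>\<^sub>n\<close> and \<open>\<zeta>\<^sub>n\<close>
  which that drift outweighs. So even its \<^emph>\<open>square\<close> is a supermartingale up to the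
  threshold, and \<open>\<Sum>\<zeta>\<^sub>n\<close> has second moment \<open>O(ln\<^sup>2 R)\<close> there. The pathwise core of this is
  \<open>lyapunov_square_step\<close>: it bounds the new square by the old one plus two terms of zero and of
  nonpositive conditional mean, whence \<open>truncated_energy_Suc_le\<close> and \<open>truncated_second_moment\<close>.

  Two difficulties are specific to the affine variance bound and the adaptive step. First, the step size
  depends on the current gradient sample. Replacing \<open>1 / sqrt S\<^sub>n\<close> by the predictable
  \<open>1 / sqrt S\<^sub>n\<^sub>-\<^sub>1\<close> costs at most \<open>(\<sigma>\<^sub>0 \<parallel>v\<^sub>n\<parallel>\<^sup>2 + \<sigma>\<^sub>1)(1 / sqrt S\<^sub>n\<^sub>-\<^sub>1 - 1 / sqrt S\<^sub>n)\<close> plus a fraction of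
  \<open>\<zeta>\<^sub>n\<close>. The \<open>\<sigma>\<^sub>0\<close> part is not small, but it is at most a fixed fraction of what the summand
  \<open>c \<zeta>\<^sub>n\<close> of the process loses through the growth of its denominator. Secondly, \<open>S\<^sub>n\<close> is unbounded, so
  the threshold may be passed. With \<open>R = T\<^sup>4\<close> the crude estimate \<open>\<parallel>v\<^sub>n\<parallel> = O(n)\<close>, which holds because a step is never longer than \<open>\<alpha>\<^sub>0\<close>, makes
  that event negligible.

  Finally \<open>sqrt S \<cdot> Y \<le> \<eta> S / 2 + Y\<^sup>2 / (2 \<eta>)\<close> is used twice (\<open>expected_gradient_sum\<close>): with a fixed
  small \<open>\<eta>\<close> it closes the loop between \<open>E S\<^sub>T \<le> S\<^sub>0 + \<sigma>\<^sub>1 T + \<sigma>\<^sub>0 E \<Sum>\<parallel>v\<^sub>n\<parallel>\<^sup>2\<close> and \<open>E \<Sum>\<parallel>v\<^sub>n\<parallel>\<^sup>2\<close>,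
  giving \<open>E S\<^sub>T = O(T)\<close>; with \<open>\<eta> = ln T / sqrt T\<close> it gives the rate. Markov's inequality concludes.
\<close>

section \<open>Smooth nonnegative functions\<close>

text \<open>The derivative of the difference of the two sides along the segment from \<open>x\<close> to \<open>x + d\<close>
  has a constant sign, by Cauchy--Schwarz and the Lipschitz condition.\<close>

lemma descent_inequality:
  fixes g :: "'a::real_inner \<Rightarrow> real"
  assumes gradient: "\<And>x. GDERIV g x :> g' x"
    and Lipschitz: "\<And>x y. norm (g' x - g' y) \<le> L * norm (x - y)"
  shows "g (x + d) \<le> g x + inner (g' x) d + L / 2 * (norm d)\<^sup>2"
proof -
  define \<phi> where "\<phi> t = g (x + t *\<^sub>R d) - t * inner (g' x) d - L / 2 * t\<^sup>2 * (norm d)\<^sup>2" for t :: real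
  have "\<phi> 1 \<le> \<phi> 0"
  proof (rule DERIV_nonpos_imp_nonincreasing[where f = \<phi>])
    fix t :: real assume t: "0 \<le> t" "t \<le> 1"
    have "((\<lambda>t. g (x + t *\<^sub>R d)) has_derivative (\<lambda>h. inner (h *\<^sub>R d) (g' (x + t *\<^sub>R d)))) (at t)"
    proof (rule has_derivative_compose[where g = g and f = "\<lambda>t. x + t *\<^sub>R d"])
      show "((\<lambda>t. x + t *\<^sub>R d) has_derivative (\<lambda>h. h *\<^sub>R d)) (at t)"
        by (auto intro!: derivative_eq_intros)
      show "(g has_derivative (\<lambda>h. inner h (g' (x + t *\<^sub>R d)))) (at (x + t *\<^sub>R d))"
        using gradient[of "x + t *\<^sub>R d"] by (simp add: gderiv_def)
    qed
    then have "((\<lambda>t. g (x + t *\<^sub>R d)) has_real_derivative inner (g' (x + t *\<^sub>R d)) d) (at t)"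
      unfolding has_field_derivative_def
      by (rule has_derivative_eq_rhs) (simp add: fun_eq_iff inner_commute)
    then have "(\<phi> has_real_derivative
        (inner (g' (x + t *\<^sub>R d)) d - inner (g' x) d - L * t * (norm d)\<^sup>2)) (at t)"
      unfolding \<phi>_def by (auto intro!: derivative_eq_intros)
    moreover have "inner (g' (x + t *\<^sub>R d)) d - inner (g' x) d \<le> L * t * (norm d)\<^sup>2"
    proof -
      have "inner (g' (x + t *\<^sub>R d) - g' x) d \<le> norm (g' (x + t *\<^sub>R d) - g' x) * norm d"
        by (rule norm_cauchy_schwarz)
      also have "\<dots> \<le> (L * norm (x + t *\<^sub>R d - x)) * norm d"
        by (intro mult_right_mono Lipschitz) simp
      finally show ?thesis using t by (simp add: inner_diff_left power2_eq_square mult.assoc)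
    qed
    ultimately show "\<exists>y. (\<phi> has_real_derivative y) (at t) \<and> y \<le> 0"
      by (intro exI[of _ "inner (g' (x + t *\<^sub>R d)) d - inner (g' x) d - L * t * (norm d)\<^sup>2"]) simp
  qed simp
  then show ?thesis by (simp add: \<phi>_def)
qed

text \<open>A gradient step of length \<open>1 / L\<close> lowers \<open>g\<close> by at least \<open>\<parallel>g' x\<parallel>\<^sup>2 / (2 L)\<close>, and it cannot lower
  it below zero.\<close>

lemma nonneg_smooth_imp_gradient_bound:
  fixes g :: "'a::real_inner \<Rightarrow> real"
  assumes gradient: "\<And>x. GDERIV g x :> g' x"
    and Lipschitz: "\<And>x y. norm (g' x - g' y) \<le> L * norm (x - y)"
    and nonneg: "\<And>x. g x \<ge> 0" and L: "L > 0"
  shows "(norm (g' x))\<^sup>2 \<le> 2 * L * g x"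
proof -
  have "0 \<le> g (x + (- (1 / L)) *\<^sub>R g' x)" by (rule nonneg)
  also have "\<dots> \<le> g x + inner (g' x) ((- (1 / L)) *\<^sub>R g' x)
      + L / 2 * (norm ((- (1 / L)) *\<^sub>R g' x))\<^sup>2"
    by (rule descent_inequality[OF gradient Lipschitz])
  also have "\<dots> = g x - (norm (g' x))\<^sup>2 / (2 * L)"
    using L by (simp add: power2_norm_eq_inner[symmetric] power_mult_distrib field_simps power2_eq_square)
  finally show ?thesis using L by (simp add: field_simps)
qed

section \<open>One step of the Lyapunov process\<close>

text \<open>
  A decrease \<open>p\<close> that may be as large as \<open>Z\<close> itself would contribute \<open>p\<^sup>2\<close> to the square. As
  \<open>p\<^sup>2 \<le> Z p\<close>, the linear term pays for it and still leaves a quarter of \<open>p\<close> to be spent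
  elsewhere, so only the square of \<open>q\<close> remains to be controlled.
\<close>

lemma square_increment_bound:
  fixes Z :: real
  assumes "0 \<le> p" "p \<le> Z" "0 \<le> Z'" "Z' \<le> Z - p + q"
  shows "Z'\<^sup>2 \<le> Z\<^sup>2 + 2 * Z * (q - p / 4) + 3 * q\<^sup>2"
proof -
  have "Z'\<^sup>2 \<le> (Z - p + q)\<^sup>2" using assms by (intro power_mono) auto
  moreover have "3/2 * (p * p) \<le> 3/2 * (Z * p)" using assms by (intro mult_left_mono mult_right_mono) auto
  moreover have "0 \<le> (p + 2 * q)\<^sup>2" by simp
  ultimately show ?thesis by (simp add: power2_eq_square algebra_simps)
qed

lemma square_sum3_le: "(x + y + z)\<^sup>2 \<le> 3 * (x\<^sup>2 + y\<^sup>2 + z\<^sup>2)" for x y z :: real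
proof -
  have "0 \<le> (x - y)\<^sup>2 + (y - z)\<^sup>2 + (x - z)\<^sup>2" by simp
  then show ?thesis by (simp add: power2_eq_square algebra_simps)
qed

text \<open>
  Enlarging \<open>L\<close>, \<open>\<sigma>\<^sub>0\<close> and \<open>\<sigma>\<^sub>1\<close> weakens the hypotheses on the process, so lower bounds for them cost
  no generality. They keep every denominator below away from zero.
\<close>

locale adagrad_constants =
  fixes \<alpha> L \<sigma>\<^sub>0 \<sigma>\<^sub>1 s\<^sub>0 :: real
  assumes \<alpha>_pos: "\<alpha> > 0" and L_pos: "L > 0" and \<sigma>\<^sub>0_ge: "\<sigma>\<^sub>0 \<ge> 1" and \<sigma>\<^sub>1_ge: "\<sigma>\<^sub>1 \<ge> 1" and s\<^sub>0_pos: "s\<^sub>0 > 0"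
begin

text \<open>
  \<open>c\<close> weighs \<open>\<zeta>\<^sub>n\<close> in the Lyapunov process: \<open>\<alpha> \<sigma>\<^sub>0\<close> would offset the price of the predictable step
  size, and the factor 4 is there because \<open>square_increment_bound\<close> leaves only a quarter of the
  decrease. \<open>D1\<close> and \<open>D2\<close> bound the increments linear in the normalised sample length and quadratic in
  it. \<open>K\<close> is the price per unit of \<open>\<Gamma>\<close>: the bracket cancels the positive part of the drift, \<open>9 D1\<^sup>2 L\<close> the square of the linear
  increments, and the final 1, together with the floor \<open>W\<close> of the process, the square of the quadratic ones.
\<close>

definition c :: real where "c = 4 * \<alpha> * \<sigma>\<^sub>0"
definition D1 :: real where "D1 = \<alpha> + 2 * c * L * \<alpha> / sqrt s\<^sub>0"
definition D2 :: real where "D2 = L * \<alpha>\<^sup>2 / 2 + c * L\<^sup>2 * \<alpha>\<^sup>2 / sqrt s\<^sub>0"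
definition K :: real where
  "K = ((2 * c * L * \<alpha>)\<^sup>2 / (\<alpha> * sqrt s\<^sub>0) + D2 + \<alpha> * \<sigma>\<^sub>1 / sqrt s\<^sub>0) + 9 * D1\<^sup>2 * L + 1"
definition W :: real where "W = 9 * (D2 + K)\<^sup>2 / 2"

lemma constants_pos: "c > 0" "D1 > 0" "D2 > 0" "K > 0" "W > 0"
proof -
  note pos = \<alpha>_pos L_pos \<sigma>\<^sub>0_ge \<sigma>\<^sub>1_ge s\<^sub>0_pos
  show c: "c > 0" using pos by (simp add: c_def)
  show "D1 > 0" using pos c by (simp add: D1_def add_pos_pos)
  show D2: "D2 > 0" using pos c by (simp add: D2_def add_pos_pos)
  show K: "K > 0" unfolding K_def using pos D2 by (intro add_nonneg_pos add_nonneg_nonneg) auto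
  show "W > 0" unfolding W_def using K D2 by simp
qed

text \<open>
  The pathwise core. Here \<open>v\<close> and \<open>w\<close> are the true gradients before and after the step, \<open>y\<close> is
  the stochastic gradient, \<open>a\<close> and \<open>S\<close> are the accumulators, \<open>G0\<close> and \<open>G1\<close> the objective values and
  \<open>Z\<close> and \<open>Z'\<close> the Lyapunov process. When \<open>a\<close>, \<open>v\<close> and \<open>Z\<close> are known and \<open>y\<close> is still random,
  unbiasedness makes the mean of the second summand on the right vanish and the variance bound makes
  that of the third one nonpositive. All else is absorbed on the spot, so that conditional
  expectations are never needed for anything but these two terms.
\<close>

lemma lyapunov_square_step:
  fixes v w y :: "'a::real_inner" and a G0 G1 Z Z' :: real
  defines "S \<equiv> a + (norm y)\<^sup>2"
  defines "h \<equiv> \<sigma>\<^sub>0 * (norm v)\<^sup>2 + \<sigma>\<^sub>1"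
  assumes a: "s\<^sub>0 \<le> a"
    and self_bound: "(norm v)\<^sup>2 \<le> 2 * L * G0" "G0 \<ge> 0"
    and descent: "G1 \<le> G0 - \<alpha> * inner v y / sqrt S + L / 2 * (\<alpha>\<^sup>2 * (norm y)\<^sup>2 / S)"
    and lip: "norm w \<le> norm v + L * (\<alpha> * norm y / sqrt S)"
    and Z: "G0 + c * ((norm v)\<^sup>2 / sqrt a) + W \<le> Z"
    and Z': "Z' = Z + (G1 + c * ((norm w)\<^sup>2 / sqrt S)) - (G0 + c * ((norm v)\<^sup>2 / sqrt a))
        + \<alpha> / 4 * ((norm v)\<^sup>2 / sqrt a) - K * ((norm y)\<^sup>2 / S)"
    and "Z' \<ge> 0"
  shows "Z'\<^sup>2 \<le> Z\<^sup>2 + 2 * \<alpha> * (Z / sqrt a * ((norm v)\<^sup>2 - inner v y))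
      + \<alpha> / 2 * (Z * (norm v)\<^sup>2 / (h * sqrt a) * ((norm y)\<^sup>2 - h))"
proof -
  note pos = \<alpha>_pos L_pos \<sigma>\<^sub>0_ge \<sigma>\<^sub>1_ge s\<^sub>0_pos constants_pos
  define t where "t = norm v"
  define x where "x = norm y"
  define I where "I = inner v y"
  define r where "r = sqrt a"
  define R where "R = sqrt S"
  define u where "u = x / R"
  define \<Delta> where "\<Delta> = 1 / r - 1 / R"
  define \<zeta> where "\<zeta> = t\<^sup>2 / r"
  define \<rho> where "\<rho> = sqrt s\<^sub>0"
  have t0: "t \<ge> 0" and x0: "x \<ge> 0" by (auto simp: t_def x_def)
  have S_pos: "S > 0" and aS: "a \<le> S" using a pos unfolding S_def by (auto intro: add_pos_nonneg)
  have \<rho>: "\<rho> > 0" "\<rho> \<le> r" using pos a by (auto simp: \<rho>_def r_def)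
  have r: "r > 0" using \<rho> by simp
  have rR: "r \<le> R" using aS by (simp add: r_def R_def)
  have R: "R > 0" using r rR by simp
  have R2: "R\<^sup>2 = S" using S_pos by (simp add: R_def)
  have r2: "r\<^sup>2 = a" using r by (simp add: r_def)
  have SRx: "R\<^sup>2 = r\<^sup>2 + x\<^sup>2" unfolding R2 r2 by (simp add: S_def x_def)
  have u0: "u \<ge> 0" using x0 R by (simp add: u_def)
  have u2: "u\<^sup>2 = x\<^sup>2 / S" by (simp add: u_def power_divide R2)
  have u2_le1: "u\<^sup>2 \<le> 1" unfolding u_def power_divide SRx using r by (simp add: divide_le_eq_1 add_pos_nonneg)
  have h1: "h > 0" unfolding h_def using pos by (intro add_nonneg_pos) auto
  have \<Delta>0: "\<Delta> \<ge> 0" using r rR by (simp add: \<Delta>_def frac_le)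
  have \<Delta>r: "\<Delta> \<le> 1 / r" using R by (simp add: \<Delta>_def)
  have \<zeta>0: "\<zeta> \<ge> 0" using r by (simp add: \<zeta>_def)
  have I: "\<bar>I\<bar> \<le> t * x" unfolding I_def t_def x_def by (rule Cauchy_Schwarz_ineq2)
  have IR: "\<bar>I / R\<bar> \<le> t * u"
    using I R by (simp add: u_def divide_right_mono)
  have inv_le: "1 / R \<le> 1 / r" "1 / R \<le> 1 / \<rho>" "1 / r \<le> 1 / \<rho>"
    using r rR R \<rho> by (auto intro!: frac_le)
  have \<Delta>u: "\<Delta> \<le> u\<^sup>2 / \<rho>"
  proof -
    have "\<Delta> = (R - r) / (r * R)" using r R by (simp add: \<Delta>_def field_simps)
    also have "\<dots> \<le> (x\<^sup>2 / R) / (r * R)"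
    proof (rule divide_right_mono)
      have "r * (R - r) \<ge> 0" using r rR by simp
      then have "(R - r) * R \<le> x\<^sup>2" using SRx by (simp add: algebra_simps power2_eq_square)
      then show "R - r \<le> x\<^sup>2 / R" using R by (simp add: field_simps)
    qed (use r R in simp)
    also have "\<dots> = u\<^sup>2 * (1 / r)" using r R by (simp add: u_def power2_eq_square)
    also have "\<dots> \<le> u\<^sup>2 * (1 / \<rho>)" using inv_le(3) by (intro mult_left_mono) auto
    finally show ?thesis by simp
  qed
  \<comment> \<open>\<open>p\<close> is what \<open>c \<zeta>\<close> loses through the growth of the denominator alone, and \<open>q\<close> collects
    the other changes, with the new gradient bounded through the old one.\<close>
  define p where "p = c * (t\<^sup>2 * \<Delta>)"
  define q where "q = - \<alpha> * (I / R) + c * ((2 * L * \<alpha> * (t * u) + L\<^sup>2 * \<alpha>\<^sup>2 * u\<^sup>2) * (1 / R))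
      + L / 2 * \<alpha>\<^sup>2 * u\<^sup>2 + \<alpha> / 4 * \<zeta> - K * u\<^sup>2"
  have p0: "p \<ge> 0" using pos \<Delta>0 by (simp add: p_def)
  have Z_ge: "G0 + c * \<zeta> + W \<le> Z" using Z by (simp add: \<zeta>_def t_def r_def)
  have "c * (t\<^sup>2 * \<Delta>) \<le> c * (t\<^sup>2 * (1 / r))"
    using \<Delta>r pos by (intro mult_left_mono) auto
  then have pZ: "p \<le> Z" using Z_ge self_bound pos by (simp add: p_def \<zeta>_def)
  have Z0: "Z \<ge> 0" using p0 pZ by simp
  have Zq: "Z' \<le> Z - p + q"
  proof -
    have "(norm w)\<^sup>2 \<le> (t + L * \<alpha> * u)\<^sup>2"
      using lip by (intro power_mono) (auto simp: t_def u_def x_def R_def)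
    also have "\<dots> = t\<^sup>2 + (2 * L * \<alpha> * (t * u) + L\<^sup>2 * \<alpha>\<^sup>2 * u\<^sup>2)" by (simp add: power2_eq_square algebra_simps)
    finally have "c * ((norm w)\<^sup>2 * (1 / R)) \<le> c * ((t\<^sup>2 + (2 * L * \<alpha> * (t * u) + L\<^sup>2 * \<alpha>\<^sup>2 * u\<^sup>2)) * (1 / R))"
      using pos R by (intro mult_left_mono mult_right_mono) auto
    moreover have "G1 \<le> G0 - \<alpha> * (I / R) + L / 2 * (\<alpha>\<^sup>2 * u\<^sup>2)"
      using descent by (simp add: I_def R_def u2 x_def)
    moreover have "Z' = Z + (G1 + c * ((norm w)\<^sup>2 * (1 / R))) - (G0 + c * (t\<^sup>2 / r)) + \<alpha> / 4 * \<zeta> - K * u\<^sup>2"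
      unfolding Z' by (simp add: u2 x_def R_def t_def r_def \<zeta>_def)
    ultimately show ?thesis unfolding p_def q_def \<Delta>_def by (simp add: algebra_simps)
  qed
  \<comment> \<open>Every contribution to \<open>q\<^sup>2\<close> carries a factor bounded by a multiple of \<open>Z\<close>: \<open>t\<^sup>2\<close> through the
    self-bounding property of \<open>g\<close>, \<open>\<zeta>\<close> through the summand \<open>c \<zeta>\<close>, and constants through \<open>W\<close>.\<close>
  have q_abs: "\<bar>q\<bar> \<le> D1 * (t * u) + \<alpha> / 4 * \<zeta> + (D2 + K) * u\<^sup>2"
  proof -
    have 1: "\<bar>\<alpha> * (I / R)\<bar> \<le> \<alpha> * (t * u)"
      using mult_left_mono[OF IR, of \<alpha>] pos by (simp add: abs_mult)
    have nn: "0 \<le> 2 * L * \<alpha> * (t * u) + L\<^sup>2 * \<alpha>\<^sup>2 * u\<^sup>2" using pos t0 u0 by simp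
    have 2: "c * ((2 * L * \<alpha> * (t * u) + L\<^sup>2 * \<alpha>\<^sup>2 * u\<^sup>2) * (1 / R))
        \<le> c * ((2 * L * \<alpha> * (t * u) + L\<^sup>2 * \<alpha>\<^sup>2 * u\<^sup>2) * (1 / \<rho>))"
      using nn pos inv_le by (intro mult_left_mono) auto
    have 3: "0 \<le> c * ((2 * L * \<alpha> * (t * u) + L\<^sup>2 * \<alpha>\<^sup>2 * u\<^sup>2) * (1 / R))"
      using nn pos R by simp
    have 4: "0 \<le> L / 2 * \<alpha>\<^sup>2 * u\<^sup>2" "0 \<le> \<alpha> / 4 * \<zeta>" "0 \<le> K * u\<^sup>2" using pos \<zeta>0 by simp_all
    have "\<bar>q\<bar> \<le> \<alpha> * (t * u) + c * ((2 * L * \<alpha> * (t * u) + L\<^sup>2 * \<alpha>\<^sup>2 * u\<^sup>2) * (1 / \<rho>))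
       + L / 2 * \<alpha>\<^sup>2 * u\<^sup>2 + \<alpha> / 4 * \<zeta> + K * u\<^sup>2"
      unfolding q_def using 1 2 3 4 by linarith
    also have "\<dots> = D1 * (t * u) + \<alpha> / 4 * \<zeta> + (D2 + K) * u\<^sup>2"
      by (simp add: D1_def D2_def \<rho>_def algebra_simps)
    finally show ?thesis .
  qed
  have q_sq: "3 * q\<^sup>2 \<le> 2 * Z * (9 * \<alpha> / 128 * \<zeta> + (9 * D1\<^sup>2 * L + 1) * u\<^sup>2)"
  proof -
    have "q\<^sup>2 \<le> (D1 * (t * u) + \<alpha> / 4 * \<zeta> + (D2 + K) * u\<^sup>2)\<^sup>2"
      using q_abs by (metis abs_ge_zero power2_abs power_mono)
    also have "\<dots> \<le> 3 * ((D1 * (t * u))\<^sup>2 + (\<alpha> / 4 * \<zeta>)\<^sup>2 + ((D2 + K) * u\<^sup>2)\<^sup>2)"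
      by (rule square_sum3_le)
    finally have 1: "3 * q\<^sup>2 \<le> 9 * (D1\<^sup>2 * (t\<^sup>2 * u\<^sup>2)) + 9 * (\<alpha>\<^sup>2 / 16 * (\<zeta> * \<zeta>)) + 9 * ((D2 + K)\<^sup>2 * (u\<^sup>2)\<^sup>2)"
      by (simp add: power_mult_distrib power_divide power2_eq_square algebra_simps)
    have "t\<^sup>2 \<le> 2 * L * Z"
    proof -
      have "c * \<zeta> \<ge> 0" using pos \<zeta>0 by simp
      then have "G0 \<le> Z" using Z_ge pos by linarith
      then have "2 * L * G0 \<le> 2 * L * Z" using pos by simp
      then show ?thesis using self_bound(1) by (simp add: t_def)
    qed
    then have 2: "D1\<^sup>2 * (t\<^sup>2 * u\<^sup>2) \<le> D1\<^sup>2 * ((2 * L * Z) * u\<^sup>2)"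
      by (intro mult_left_mono mult_right_mono) auto
    have "c * \<zeta> \<le> Z" using Z_ge self_bound pos by linarith
    then have "\<alpha> / (64 * \<sigma>\<^sub>0) * \<zeta> * (c * \<zeta>) \<le> \<alpha> / (64 * \<sigma>\<^sub>0) * \<zeta> * Z"
      using pos \<zeta>0 by (intro mult_left_mono) auto
    also have "\<dots> \<le> \<alpha> / 64 * \<zeta> * Z"
      using pos \<zeta>0 Z0 by (intro mult_right_mono frac_le) auto
    also have "\<alpha> / (64 * \<sigma>\<^sub>0) * \<zeta> * (c * \<zeta>) = \<alpha>\<^sup>2 / 16 * (\<zeta> * \<zeta>)"
      using pos by (simp add: c_def power2_eq_square)
    finally have 3: "\<alpha>\<^sup>2 / 16 * (\<zeta> * \<zeta>) \<le> \<alpha> / 64 * \<zeta> * Z" .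
    have "(u\<^sup>2)\<^sup>2 \<le> u\<^sup>2" using u2_le1 by (simp add: power2_eq_square mult_left_le)
    then have "9 * ((D2 + K)\<^sup>2 * (u\<^sup>2)\<^sup>2) \<le> 9 * ((D2 + K)\<^sup>2 * u\<^sup>2)" by (simp add: mult_left_mono)
    also have "\<dots> = 2 * W * u\<^sup>2" by (simp add: W_def)
    also have "W \<le> Z" using Z_ge self_bound pos \<zeta>0
      by (smt (verit) mult_nonneg_nonneg)
    then have "2 * W * u\<^sup>2 \<le> 2 * Z * u\<^sup>2" by (simp add: mult_right_mono)
    finally show ?thesis using 1 2 3 by (simp add: algebra_simps)
  qed
  \<comment> \<open>The predictable step size replaces the actual one at the price \<open>I \<Delta>\<close>. Young's inequality with
    weight \<open>h\<close> splits this price into a multiple of \<open>\<parallel>y\<parallel>\<^sup>2\<close>, whose mean is at most that of the same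
    multiple of \<open>h\<close>, and \<open>h \<Delta>\<close>, whose \<open>\<sigma>\<^sub>0\<close> part, multiplied by \<open>\<alpha>\<close>, is exactly \<open>p / 4\<close>.\<close>
  have drift: "q - p / 4 \<le> - \<alpha> * (I / r) + \<alpha> * (t\<^sup>2 * x\<^sup>2 / (4 * h * r)) + \<alpha> / 2 * \<zeta>
      - (9 * D1\<^sup>2 * L + 1) * u\<^sup>2"
  proof -
    have *: "t * x \<le> t\<^sup>2 * x\<^sup>2 / (4 * h) + h"
    proof -
      have "0 \<le> (t * x - 2 * h)\<^sup>2 / (4 * h)" using h1 by simp
      also have "\<dots> = t\<^sup>2 * x\<^sup>2 / (4 * h) + h - t * x"
        using h1 by (simp add: field_simps power2_eq_square)
      finally show ?thesis by simp
    qed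
    have "I * \<Delta> \<le> (t\<^sup>2 * x\<^sup>2 / (4 * h) + h) * \<Delta>"
      using I * \<Delta>0 by (intro mult_right_mono) auto
    also have "\<dots> \<le> t\<^sup>2 * x\<^sup>2 / (4 * h) * (1 / r) + h * \<Delta>"
      using mult_left_mono[OF \<Delta>r, of "t\<^sup>2 * x\<^sup>2 / (4 * h)"] h1 by (simp add: algebra_simps)
    also have "h * \<Delta> \<le> \<sigma>\<^sub>0 * (t\<^sup>2 * \<Delta>) + \<sigma>\<^sub>1 * (u\<^sup>2 / \<rho>)"
      using mult_left_mono[OF \<Delta>u, of \<sigma>\<^sub>1] pos by (simp add: h_def t_def algebra_simps)
    finally have 1: "\<alpha> * (I * \<Delta>) \<le> \<alpha> * (t\<^sup>2 * x\<^sup>2 / (4 * h * r) + \<sigma>\<^sub>0 * (t\<^sup>2 * \<Delta>) + \<sigma>\<^sub>1 * (u\<^sup>2 / \<rho>))"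
      using pos by (intro mult_left_mono) auto
    have 2: "- \<alpha> * (I / R) = - \<alpha> * (I / r) + \<alpha> * (I * \<Delta>)"
      by (simp add: \<Delta>_def algebra_simps)
    define c1 where "c1 = 2 * c * L * \<alpha>"
    have c1: "c1 > 0" using pos by (simp add: c1_def)
    have 3: "c1 * (t * u) * (1 / R) \<le> \<alpha> / 4 * \<zeta> + c1\<^sup>2 / (\<alpha> * \<rho>) * u\<^sup>2"
    proof -
      have "0 \<le> (\<alpha> / 2 * t - c1 * u)\<^sup>2 / \<alpha>" using pos by simp
      also have "\<dots> = \<alpha> / 4 * t\<^sup>2 + c1\<^sup>2 / \<alpha> * u\<^sup>2 - c1 * (t * u)"
        using pos by (simp add: field_simps power2_eq_square)
      finally have *: "c1 * (t * u) \<le> \<alpha> / 4 * t\<^sup>2 + c1\<^sup>2 / \<alpha> * u\<^sup>2" by simp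
      have "c1 * (t * u) * (1 / R) \<le> c1 * (t * u) * (1 / r)"
        using c1 t0 u0 inv_le by (intro mult_left_mono) auto
      also have "\<dots> \<le> (\<alpha> / 4 * t\<^sup>2 + c1\<^sup>2 / \<alpha> * u\<^sup>2) * (1 / r)"
        using * r by (intro mult_right_mono) auto
      also have "\<dots> = \<alpha> / 4 * \<zeta> + c1\<^sup>2 / \<alpha> * u\<^sup>2 * (1 / r)" by (simp add: \<zeta>_def algebra_simps add_divide_distrib)
      also have "c1\<^sup>2 / \<alpha> * u\<^sup>2 * (1 / r) \<le> c1\<^sup>2 / \<alpha> * u\<^sup>2 * (1 / \<rho>)"
        using pos inv_le by (intro mult_left_mono) auto
      finally show ?thesis by (simp add: algebra_simps)
    qed
    have 4: "c * (L\<^sup>2 * \<alpha>\<^sup>2 * u\<^sup>2 * (1 / R)) \<le> c * (L\<^sup>2 * \<alpha>\<^sup>2 * u\<^sup>2 * (1 / \<rho>))"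
      using pos inv_le by (intro mult_left_mono) auto
    have q_eq: "q = - \<alpha> * (I / R) + c1 * (t * u) * (1 / R) + c * (L\<^sup>2 * \<alpha>\<^sup>2 * u\<^sup>2 * (1 / R))
        + L / 2 * \<alpha>\<^sup>2 * u\<^sup>2 + \<alpha> / 4 * \<zeta> - K * u\<^sup>2"
      unfolding q_def c1_def by (simp add: algebra_simps)
    have p_eq: "p / 4 = \<alpha> * (\<sigma>\<^sub>0 * (t\<^sup>2 * \<Delta>))" by (simp add: p_def c_def)
    have K_eq: "K * u\<^sup>2 = c1\<^sup>2 / (\<alpha> * \<rho>) * u\<^sup>2 + (L / 2 * \<alpha>\<^sup>2 * u\<^sup>2 + c * (L\<^sup>2 * \<alpha>\<^sup>2 * u\<^sup>2 * (1 / \<rho>)))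
        + \<alpha> * (\<sigma>\<^sub>1 * (u\<^sup>2 / \<rho>)) + (9 * D1\<^sup>2 * L + 1) * u\<^sup>2"
      unfolding K_def D2_def \<rho>_def[symmetric] c1_def[symmetric] by (simp add: algebra_simps)
    show ?thesis unfolding q_eq p_eq K_eq using 1 2 3 4 by (simp only: distrib_left)
  qed
  have "Z'\<^sup>2 \<le> Z\<^sup>2 + 2 * Z * (q - p / 4) + 3 * q\<^sup>2"
    by (rule square_increment_bound[OF p0 pZ \<open>Z' \<ge> 0\<close> Zq])
  also have "\<dots> \<le> Z\<^sup>2 + 2 * Z * (- \<alpha> * (I / r) + \<alpha> * (t\<^sup>2 * x\<^sup>2 / (4 * h * r)) + \<alpha> / 2 * \<zeta>
      - (9 * D1\<^sup>2 * L + 1) * u\<^sup>2) + 2 * Z * (9 * \<alpha> / 128 * \<zeta> + (9 * D1\<^sup>2 * L + 1) * u\<^sup>2)"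
    using drift q_sq Z0 by (intro add_mono mult_left_mono) auto
  also have "\<dots> = Z\<^sup>2 + 2 * Z * (- \<alpha> * (I / r) + \<alpha> * (t\<^sup>2 * x\<^sup>2 / (4 * h * r)) + \<alpha> * (73 / 128) * \<zeta>)"
    by (simp add: algebra_simps)
  also have "\<dots> \<le> Z\<^sup>2 + 2 * Z * (- \<alpha> * (I / r) + \<alpha> * (t\<^sup>2 * x\<^sup>2 / (4 * h * r)) + \<alpha> * (3 / 4) * \<zeta>)"
  proof -
    have "\<alpha> * (73 / 128) * \<zeta> \<le> \<alpha> * (3 / 4) * \<zeta>"
      using pos \<zeta>0 by (intro mult_right_mono mult_left_mono) auto
    then show ?thesis using Z0 by (intro add_left_mono mult_left_mono) auto
  qed
  also have "\<dots> = Z\<^sup>2 + 2 * \<alpha> * (Z / r * (t\<^sup>2 - I)) + \<alpha> / 2 * (Z * t\<^sup>2 / (h * r) * (x\<^sup>2 - h))"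
    using h1 r by (simp add: \<zeta>_def field_simps)
  finally show ?thesis by (simp add: t_def x_def I_def r_def)
qed

end


section \<open>The process and its pathwise bounds\<close>

text \<open>
  Indices are shifted against the customary ones: \<open>x n\<close>, \<open>s n\<close> and \<open>y n\<close> stand for
  \<open>\<theta>\<^sub>n\<^sub>+\<^sub>1\<close>, \<open>S\<^sub>n\<close> and \<open>\<nabla>g(\<theta>\<^sub>n\<^sub>+\<^sub>1, \<xi>\<^sub>n\<^sub>+\<^sub>1)\<close>, so that \<open>x n\<close> and \<open>s n\<close> are known at time \<open>n\<close> and \<open>y n\<close>
  is the sample drawn next. The samples are described by a filtration and their first two
  conditional moments.
\<close>

locale adagrad_process = adagrad_constants \<alpha> L \<sigma>\<^sub>0 \<sigma>\<^sub>1 s\<^sub>0 + prob_space M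
  for \<alpha> L \<sigma>\<^sub>0 \<sigma>\<^sub>1 s\<^sub>0 :: real and M :: "'w measure" +
  fixes F :: "nat \<Rightarrow> 'w measure"
    and g :: "'a::euclidean_space \<Rightarrow> real" and g' :: "'a \<Rightarrow> 'a"
    and x y :: "nat \<Rightarrow> 'w \<Rightarrow> 'a" and s :: "nat \<Rightarrow> 'w \<Rightarrow> real" and x\<^sub>0 :: 'a
  assumes subalg: "\<And>n. subalgebra M (F n)"
    and filtration: "\<And>m n. m \<le> n \<Longrightarrow> subalgebra (F n) (F m)"
    and x_adapted: "\<And>n. x n \<in> borel_measurable (F n)"
    and s_adapted: "\<And>n. s n \<in> borel_measurable (F n)"
    and y_measurable [measurable]: "\<And>n. y n \<in> borel_measurable M"
    and gradient: "\<And>z. GDERIV g z :> g' z"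
    and nonneg: "\<And>z. g z \<ge> 0"
    and Lipschitz: "\<And>z z'. norm (g' z - g' z') \<le> L * norm (z - z')"
    and x_0: "\<And>\<omega>. \<omega> \<in> space M \<Longrightarrow> x 0 \<omega> = x\<^sub>0"
    and s_0: "\<And>\<omega>. \<omega> \<in> space M \<Longrightarrow> s 0 \<omega> = s\<^sub>0"
    and s_Suc: "\<And>n \<omega>. \<omega> \<in> space M \<Longrightarrow> s (Suc n) \<omega> = s n \<omega> + (norm (y n \<omega>))\<^sup>2"
    and x_Suc: "\<And>n \<omega>. \<omega> \<in> space M \<Longrightarrow>
      x (Suc n) \<omega> = x n \<omega> - (\<alpha> / sqrt (s (Suc n) \<omega>)) *\<^sub>R y n \<omega>"
    and unbiased: "\<And>n. AE \<omega> in M. vec_cond_exp M (F n) (y n) \<omega> = g' (x n \<omega>)"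
    and affine_variance: "\<And>n. AE \<omega> in M.
      nn_cond_exp M (F n) (\<lambda>\<omega>. ennreal ((norm (y n \<omega>))\<^sup>2)) \<omega>
        \<le> ennreal (\<sigma>\<^sub>0 * (norm (g' (x n \<omega>)))\<^sup>2 + \<sigma>\<^sub>1)"
begin

text \<open>\<open>h n\<close> is the bound on the conditional second moment of \<open>y n\<close>, and \<open>grad_bound\<close> the deterministic bound that
  \<open>v_bound\<close> derives from the limited step length.\<close>

definition v :: "nat \<Rightarrow> 'w \<Rightarrow> 'a" where "v n \<omega> = g' (x n \<omega>)"
definition \<zeta> :: "nat \<Rightarrow> 'w \<Rightarrow> real" where "\<zeta> n \<omega> = (norm (v n \<omega>))\<^sup>2 / sqrt (s n \<omega>)"
definition \<Gamma> :: "nat \<Rightarrow> 'w \<Rightarrow> real" where "\<Gamma> n \<omega> = (norm (y n \<omega>))\<^sup>2 / s (Suc n) \<omega>"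
definition h :: "nat \<Rightarrow> 'w \<Rightarrow> real" where "h n \<omega> = \<sigma>\<^sub>0 * (norm (v n \<omega>))\<^sup>2 + \<sigma>\<^sub>1"
definition grad_bound :: "nat \<Rightarrow> real" where "grad_bound n = norm (g' x\<^sub>0) + L * \<alpha> * real n"

lemma s_ge: "\<omega> \<in> space M \<Longrightarrow> s\<^sub>0 \<le> s n \<omega>"
  by (induction n) (auto simp: s_0 s_Suc intro: order_trans)

lemma s_pos: "\<omega> \<in> space M \<Longrightarrow> 0 < s n \<omega>"
  using s_ge[of \<omega> n] s\<^sub>0_pos by simp

lemma s_Suc_le: "\<omega> \<in> space M \<Longrightarrow> s n \<omega> \<le> s (Suc n) \<omega>"
  by (simp add: s_Suc)

lemma s_mono: "\<omega> \<in> space M \<Longrightarrow> m \<le> n \<Longrightarrow> s m \<omega> \<le> s n \<omega>"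
  by (rule lift_Suc_mono_le[of "\<lambda>n. s n \<omega>"]) (auto intro: s_Suc_le)

lemma \<zeta>_nonneg: "\<omega> \<in> space M \<Longrightarrow> 0 \<le> \<zeta> n \<omega>"
  using s_pos[of \<omega> n] by (simp add: \<zeta>_def)

lemma h_ge: "h n \<omega> \<ge> 1"
  using \<sigma>\<^sub>0_ge \<sigma>\<^sub>1_ge unfolding h_def by (intro add_increasing) auto

lemma h_nonneg: "h n \<omega> \<ge> 0"
  using h_ge[of n \<omega>] by simp

lemma \<Gamma>_bounds:
  assumes "\<omega> \<in> space M"
  shows "0 \<le> \<Gamma> n \<omega>" "\<Gamma> n \<omega> \<le> 1"
  using s_pos[OF assms, of n] s_pos[OF assms, of "Suc n"]
  by (simp_all add: \<Gamma>_def s_Suc[OF assms] divide_le_eq_1)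

text \<open>A Riemann-sum comparison: \<open>\<Gamma> n = 1 - s n / s (n + 1)\<close> is at most \<open>ln (s (n + 1) / s n)\<close>.\<close>

lemma sum_\<Gamma>_le_ln:
  assumes \<omega>: "\<omega> \<in> space M"
  shows "(\<Sum>i<n. \<Gamma> i \<omega>) \<le> ln (s n \<omega> / s\<^sub>0)"
proof (induction n)
  case 0 then show ?case using s\<^sub>0_pos by (simp add: s_0[OF \<omega>])
next
  case (Suc n)
  note pos = s_pos[OF \<omega>, of n] s_pos[OF \<omega>, of "Suc n"]
  have "ln (s n \<omega> / s (Suc n) \<omega>) \<le> s n \<omega> / s (Suc n) \<omega> - 1"
    using pos by (intro ln_le_minus_one) simp
  also have "\<dots> = - \<Gamma> n \<omega>" using pos by (simp add: \<Gamma>_def s_Suc[OF \<omega>] field_simps)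
  finally have "\<Gamma> n \<omega> \<le> ln (s (Suc n) \<omega>) - ln (s n \<omega>)" using pos by (simp add: ln_div)
  then show ?case using Suc pos s\<^sub>0_pos by (simp add: ln_div)
qed

text \<open>Because \<open>s (n + 1)\<close> already includes \<open>\<parallel>y n\<parallel>\<^sup>2\<close>, no step is longer than \<open>\<alpha>\<close>, whatever the noise.
  At each fixed time this bounds the iterate and its gradient, and so, by the variance bound, the second
  moment of \<open>y n\<close>.\<close>

lemma iterate_distance:
  assumes \<omega>: "\<omega> \<in> space M"
  shows "norm (x n \<omega> - x\<^sub>0) \<le> \<alpha> * real n"
proof (induction n)
  case 0 then show ?case by (simp add: x_0[OF \<omega>])
next
  case (Suc n)
  have "norm (y n \<omega>) \<le> sqrt (s (Suc n) \<omega>)"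
    using s_pos[OF \<omega>, of n] by (intro real_le_rsqrt) (simp add: s_Suc[OF \<omega>])
  then have "\<alpha> * (norm (y n \<omega>) / sqrt (s (Suc n) \<omega>)) \<le> \<alpha> * 1"
    using s_pos[OF \<omega>, of "Suc n"] \<alpha>_pos by (intro mult_left_mono) (auto simp: divide_le_eq_1)
  then have step: "norm ((\<alpha> / sqrt (s (Suc n) \<omega>)) *\<^sub>R y n \<omega>) \<le> \<alpha>"
    using s_pos[OF \<omega>, of "Suc n"] \<alpha>_pos by simp
  have "norm (x (Suc n) \<omega> - x\<^sub>0) \<le> norm (x n \<omega> - x\<^sub>0) + norm ((\<alpha> / sqrt (s (Suc n) \<omega>)) *\<^sub>R y n \<omega>)"
    using norm_triangle_ineq4[of "x n \<omega> - x\<^sub>0" "(\<alpha> / sqrt (s (Suc n) \<omega>)) *\<^sub>R y n \<omega>"]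
    by (simp add: x_Suc[OF \<omega>] algebra_simps)
  also have "\<dots> \<le> \<alpha> * real (Suc n)" using Suc step by (simp add: algebra_simps)
  finally show ?case .
qed

lemma v_bound:
  assumes \<omega>: "\<omega> \<in> space M"
  shows "norm (v n \<omega>) \<le> grad_bound n"
proof -
  have "norm (v n \<omega>) \<le> norm (g' x\<^sub>0) + norm (g' (x n \<omega>) - g' x\<^sub>0)"
    unfolding v_def by (metis add.commute diff_add_cancel norm_triangle_ineq)
  also have "norm (g' (x n \<omega>) - g' x\<^sub>0) \<le> L * (\<alpha> * real n)"
    using Lipschitz[of "x n \<omega>" x\<^sub>0]
    by (rule order_trans) (intro mult_left_mono iterate_distance[OF \<omega>] less_imp_le[OF L_pos])
  finally show ?thesis by (simp add: grad_bound_def mult.assoc)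
qed

lemma grad_bound_nonneg: "0 \<le> grad_bound n"
  using L_pos \<alpha>_pos by (simp add: grad_bound_def)

lemma grad_bound_mono: "m \<le> n \<Longrightarrow> grad_bound m \<le> grad_bound n"
  using L_pos \<alpha>_pos by (simp add: grad_bound_def mult_left_mono)

lemma v_sq_bound: "\<omega> \<in> space M \<Longrightarrow> (norm (v n \<omega>))\<^sup>2 \<le> (grad_bound n)\<^sup>2"
  by (intro power_mono v_bound) auto

lemma h_bound: "\<omega> \<in> space M \<Longrightarrow> h n \<omega> \<le> \<sigma>\<^sub>0 * (grad_bound n)\<^sup>2 + \<sigma>\<^sub>1"
  unfolding h_def using v_sq_bound[of \<omega> n] \<sigma>\<^sub>0_ge by (simp add: mult_left_mono)

lemma continuous_g: "continuous_on UNIV g"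
proof -
  have "g differentiable (at z)" for z
    using gradient[of z] unfolding gderiv_def differentiable_def by blast
  then show ?thesis
    by (auto intro!: continuous_at_imp_continuous_on differentiable_imp_continuous_within)
qed

lemma continuous_g': "continuous_on UNIV g'"
proof -
  have "L-lipschitz_on UNIV g'"
    using Lipschitz L_pos by (intro lipschitz_onI) (auto simp: dist_norm)
  then show ?thesis by (rule lipschitz_on_continuous_on)
qed

lemma g_measurable [measurable]: "g \<in> borel_measurable borel" "g' \<in> borel_measurable borel"
  using continuous_g continuous_g' by (auto intro: borel_measurable_continuous_onI)

lemma g_bounded: "\<exists>B. \<forall>\<omega>\<in>space M. g (x n \<omega>) \<le> B"
proof -
  have "bounded (g ` cball x\<^sub>0 (\<alpha> * real n))"
    using continuous_g by (intro compact_imp_bounded compact_continuous_image)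
      (auto intro: continuous_on_subset)
  then obtain B where B: "\<And>z. z \<in> cball x\<^sub>0 (\<alpha> * real n) \<Longrightarrow> norm (g z) \<le> B"
    unfolding bounded_iff by blast
  have "g (x n \<omega>) \<le> B" if "\<omega> \<in> space M" for \<omega>
  proof -
    have "x n \<omega> \<in> cball x\<^sub>0 (\<alpha> * real n)"
      using iterate_distance[OF that, of n] by (simp add: dist_norm norm_minus_commute)
    from B[OF this] show ?thesis by simp
  qed
  then show ?thesis by blast
qed

section \<open>Adaptedness and conditional moments\<close>

lemma adapted_later: "f \<in> borel_measurable (F m) \<Longrightarrow> m \<le> n \<Longrightarrow> f \<in> borel_measurable (F n)"
  using measurable_from_subalg[OF filtration] by blast

lemma adapted_measurable: "f \<in> borel_measurable (F n) \<Longrightarrow> f \<in> borel_measurable M"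
  using measurable_from_subalg[OF subalg] by blast

lemma adapted:
  shows v_adapted: "v n \<in> borel_measurable (F n)"
    and \<zeta>_adapted: "\<zeta> n \<in> borel_measurable (F n)"
    and h_adapted: "h n \<in> borel_measurable (F n)"
proof -
  note [measurable] = x_adapted s_adapted
  show v: "v n \<in> borel_measurable (F n)" unfolding v_def[abs_def] by measurable
  note [measurable] = v
  show "\<zeta> n \<in> borel_measurable (F n)" "h n \<in> borel_measurable (F n)"
    unfolding \<zeta>_def[abs_def] h_def[abs_def] by measurable
qed

text \<open>Being the relative increment of \<open>s\<close>, \<open>\<Gamma> n\<close> is known as soon as \<open>s (n + 1)\<close> is.\<close>

lemma \<Gamma>_adapted: "\<Gamma> n \<in> borel_measurable (F (Suc n))"
proof -
  note [measurable] = s_adapted[of "Suc n"] adapted_later[OF s_adapted[of n], of "Suc n"]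
  have sp: "space (F (Suc n)) = space M" using subalg[of "Suc n"] by (simp add: subalgebra_def)
  have "(\<lambda>\<omega>. (s (Suc n) \<omega> - s n \<omega>) / s (Suc n) \<omega>) \<in> borel_measurable (F (Suc n))" by measurable
  moreover have "\<Gamma> n \<omega> = (s (Suc n) \<omega> - s n \<omega>) / s (Suc n) \<omega>" if "\<omega> \<in> space (F (Suc n))" for \<omega>
    using that by (simp add: \<Gamma>_def s_Suc sp)
  ultimately show ?thesis by (simp cong: measurable_cong)
qed

lemma measurable_M [measurable]:
  "x n \<in> borel_measurable M" "s n \<in> borel_measurable M" "v n \<in> borel_measurable M"
  "\<zeta> n \<in> borel_measurable M" "h n \<in> borel_measurable M" "\<Gamma> n \<in> borel_measurable M"
  using x_adapted s_adapted adapted \<Gamma>_adapted adapted_measurable by blast+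

lemma integrable_bounded_on:
  fixes f :: "'w \<Rightarrow> real"
  assumes "f \<in> borel_measurable M" "\<And>\<omega>. \<omega> \<in> space M \<Longrightarrow> \<bar>f \<omega>\<bar> \<le> B"
  shows "integrable M f"
  using assms by (intro integrable_const_bound[where B = B]) (auto intro: AE_I2)

lemma cond_exp_subalgebra: "sigma_finite_subalgebra M (F n)"
proof -
  interpret finite_measure_subalgebra M "F n" by unfold_locales (rule subalg)
  show ?thesis by unfold_locales
qed

lemma y_sq_integrable: "integrable M (\<lambda>\<omega>. (norm (y n \<omega>))\<^sup>2)"
proof -
  interpret Fn: sigma_finite_subalgebra M "F n" by (rule cond_exp_subalgebra)
  let ?B = "\<sigma>\<^sub>0 * (grad_bound n)\<^sup>2 + \<sigma>\<^sub>1"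
  have "(\<integral>\<^sup>+\<omega>. ennreal ((norm (y n \<omega>))\<^sup>2) \<partial>M)
      = (\<integral>\<^sup>+\<omega>. 1 * nn_cond_exp M (F n) (\<lambda>\<omega>. ennreal ((norm (y n \<omega>))\<^sup>2)) \<omega> \<partial>M)"
    by (subst Fn.nn_cond_exp_intg) auto
  also have "\<dots> \<le> (\<integral>\<^sup>+\<omega>. ennreal ?B \<partial>M)"
  proof (rule nn_integral_mono_AE)
    show "AE \<omega> in M. 1 * nn_cond_exp M (F n) (\<lambda>\<omega>. ennreal ((norm (y n \<omega>))\<^sup>2)) \<omega> \<le> ennreal ?B"
      using affine_variance[of n] AE_space
    proof eventually_elim
      case (elim \<omega>)
      then show ?case using h_bound[of \<omega> n] unfolding h_def v_def
        by (simp only: mult_1) (blast intro: order_trans ennreal_leI)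
    qed
  qed
  also have "\<dots> < \<infinity>" by (simp add: emeasure_space_1)
  finally show ?thesis by (intro integrableI_nonneg) auto
qed

lemma norm_y_integrable: "integrable M (\<lambda>\<omega>. norm (y n \<omega>))"
proof (rule Bochner_Integration.integrable_bound[OF Bochner_Integration.integrable_add[OF y_sq_integrable[of n] integrable_const[of 1]]])
  have "t \<le> t\<^sup>2 + 1" for t :: real
  proof -
    have "0 \<le> (t - 1 / 2)\<^sup>2" by simp
    then show ?thesis by (simp add: power2_eq_square algebra_simps)
  qed
  then show "AE \<omega> in M. norm (norm (y n \<omega>)) \<le> norm ((norm (y n \<omega>))\<^sup>2 + 1)"
    by (auto intro!: AE_I2)
qed simp

text \<open>
  The two moment hypotheses in the form in which they are used: tested against a bounded weight known
  at time \<open>n\<close>.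
\<close>

lemma variance_pairing:
  assumes \<psi>: "\<psi> \<in> borel_measurable (F n)"
    and bnd: "\<And>\<omega>. \<omega> \<in> space M \<Longrightarrow> 0 \<le> \<psi> \<omega> \<and> \<psi> \<omega> \<le> B"
  shows "integrable M (\<lambda>\<omega>. \<psi> \<omega> * ((norm (y n \<omega>))\<^sup>2 - h n \<omega>))"
    and "(\<integral>\<omega>. \<psi> \<omega> * ((norm (y n \<omega>))\<^sup>2 - h n \<omega>) \<partial>M) \<le> 0"
proof -
  interpret Fn: sigma_finite_subalgebra M "F n" by (rule cond_exp_subalgebra)
  have [measurable]: "\<psi> \<in> borel_measurable M" by (rule adapted_measurable[OF \<psi>])
  have int1: "integrable M (\<lambda>\<omega>. \<psi> \<omega> * (norm (y n \<omega>))\<^sup>2)"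
  proof (rule Bochner_Integration.integrable_bound[where f = "\<lambda>\<omega>. B * (norm (y n \<omega>))\<^sup>2"])
    show "AE \<omega> in M. norm (\<psi> \<omega> * (norm (y n \<omega>))\<^sup>2) \<le> norm (B * (norm (y n \<omega>))\<^sup>2)"
    proof (rule AE_I2)
      fix \<omega> assume "\<omega> \<in> space M"
      then show "norm (\<psi> \<omega> * (norm (y n \<omega>))\<^sup>2) \<le> norm (B * (norm (y n \<omega>))\<^sup>2)"
        using bnd[of \<omega>] by (simp add: abs_mult mult_right_mono)
    qed
  qed (simp_all add: y_sq_integrable)
  have "0 \<le> B" using bnd not_empty by (metis ex_in_conv order_trans)
  have int2: "integrable M (\<lambda>\<omega>. \<psi> \<omega> * h n \<omega>)"
  proof (rule integrable_bounded_on[where B = "B * (\<sigma>\<^sub>0 * (grad_bound n)\<^sup>2 + \<sigma>\<^sub>1)"])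
    fix \<omega> assume "\<omega> \<in> space M"
    then show "\<bar>\<psi> \<omega> * h n \<omega>\<bar> \<le> B * (\<sigma>\<^sub>0 * (grad_bound n)\<^sup>2 + \<sigma>\<^sub>1)"
      using bnd[of \<omega>] h_bound[of \<omega> n] h_ge[of n \<omega>] \<open>0 \<le> B\<close> by (auto simp: abs_mult intro!: mult_mono)
  qed simp
  show "integrable M (\<lambda>\<omega>. \<psi> \<omega> * ((norm (y n \<omega>))\<^sup>2 - h n \<omega>))"
    using int1 int2 by (simp add: right_diff_distrib)
  have "ennreal (\<integral>\<omega>. \<psi> \<omega> * (norm (y n \<omega>))\<^sup>2 \<partial>M) = (\<integral>\<^sup>+\<omega>. ennreal (\<psi> \<omega> * (norm (y n \<omega>))\<^sup>2) \<partial>M)"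
    using int1 bnd by (intro nn_integral_eq_integral[symmetric]) (auto intro!: AE_I2)
  also have "\<dots> = (\<integral>\<^sup>+\<omega>. ennreal (\<psi> \<omega>) * ennreal ((norm (y n \<omega>))\<^sup>2) \<partial>M)"
    using bnd by (intro nn_integral_cong) (simp add: ennreal_mult)
  also have "\<dots> = (\<integral>\<^sup>+\<omega>. ennreal (\<psi> \<omega>) * nn_cond_exp M (F n) (\<lambda>\<omega>. ennreal ((norm (y n \<omega>))\<^sup>2)) \<omega> \<partial>M)"
    using \<psi> by (subst Fn.nn_cond_exp_intg) auto
  also have "\<dots> \<le> (\<integral>\<^sup>+\<omega>. ennreal (\<psi> \<omega>) * ennreal (h n \<omega>) \<partial>M)"
  proof (rule nn_integral_mono_AE)
    show "AE \<omega> in M. ennreal (\<psi> \<omega>) * nn_cond_exp M (F n) (\<lambda>\<omega>. ennreal ((norm (y n \<omega>))\<^sup>2)) \<omega>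
        \<le> ennreal (\<psi> \<omega>) * ennreal (h n \<omega>)"
      using affine_variance[of n] by eventually_elim (auto simp: h_def v_def intro: mult_left_mono)
  qed
  also have "\<dots> = (\<integral>\<^sup>+\<omega>. ennreal (\<psi> \<omega> * h n \<omega>) \<partial>M)"
    using bnd h_nonneg[of n] by (intro nn_integral_cong) (simp add: ennreal_mult)
  also have "\<dots> = ennreal (\<integral>\<omega>. \<psi> \<omega> * h n \<omega> \<partial>M)"
    using int2 bnd h_nonneg[of n] by (intro nn_integral_eq_integral) (auto intro!: AE_I2)
  finally have "(\<integral>\<omega>. \<psi> \<omega> * (norm (y n \<omega>))\<^sup>2 \<partial>M) \<le> (\<integral>\<omega>. \<psi> \<omega> * h n \<omega> \<partial>M)"
    using bnd h_nonneg[of n]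
    by (subst (asm) ennreal_le_iff) (auto intro!: integral_nonneg_AE AE_I2)
  then show "(\<integral>\<omega>. \<psi> \<omega> * ((norm (y n \<omega>))\<^sup>2 - h n \<omega>) \<partial>M) \<le> 0"
    using int1 int2 by (simp add: right_diff_distrib)
qed

lemma unbiased_pairing:
  assumes \<phi>: "\<phi> \<in> borel_measurable (F n)"
    and bnd: "\<And>\<omega>. \<omega> \<in> space M \<Longrightarrow> \<bar>\<phi> \<omega>\<bar> \<le> B"
  shows "integrable M (\<lambda>\<omega>. \<phi> \<omega> * ((norm (v n \<omega>))\<^sup>2 - inner (v n \<omega>) (y n \<omega>)))"
    and "(\<integral>\<omega>. \<phi> \<omega> * ((norm (v n \<omega>))\<^sup>2 - inner (v n \<omega>) (y n \<omega>)) \<partial>M) = 0"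
proof -
  interpret Fn: sigma_finite_subalgebra M "F n" by (rule cond_exp_subalgebra)
  have [measurable]: "\<phi> \<in> borel_measurable M" by (rule adapted_measurable[OF \<phi>])
  note [measurable] = v_adapted[of n] \<phi>
  have B: "0 \<le> B" using bnd not_empty by (metis abs_ge_zero ex_in_conv order_trans)
  have vb: "\<bar>inner (v n \<omega>) b\<bar> \<le> grad_bound n" if "\<omega> \<in> space M" "b \<in> Basis" for \<omega> b
    using Basis_le_norm[OF that(2), of "v n \<omega>"] v_bound[OF that(1), of n] by simp
  have int: "integrable M (\<lambda>\<omega>. (\<phi> \<omega> * inner (v n \<omega>) b) * inner (y n \<omega>) b)"
    and int': "integrable M (\<lambda>\<omega>. (\<phi> \<omega> * inner (v n \<omega>) b) * inner (v n \<omega>) b)"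
    and eq: "(\<integral>\<omega>. (\<phi> \<omega> * inner (v n \<omega>) b) * inner (y n \<omega>) b \<partial>M)
      = (\<integral>\<omega>. (\<phi> \<omega> * inner (v n \<omega>) b) * inner (v n \<omega>) b \<partial>M)" if b: "b \<in> Basis" for b
  proof -
    have coeff: "\<bar>\<phi> \<omega> * inner (v n \<omega>) b\<bar> \<le> B * grad_bound n" if "\<omega> \<in> space M" for \<omega>
      using bnd[OF that] vb[OF that b] B by (simp add: abs_mult mult_mono)
    show i: "integrable M (\<lambda>\<omega>. (\<phi> \<omega> * inner (v n \<omega>) b) * inner (y n \<omega>) b)"
    proof (rule Bochner_Integration.integrable_bound[where f = "\<lambda>\<omega>. (B * grad_bound n) * norm (y n \<omega>)"])
      show "AE \<omega> in M. norm (\<phi> \<omega> * inner (v n \<omega>) b * inner (y n \<omega>) b) \<le> norm (B * grad_bound n * norm (y n \<omega>))"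
      proof (rule AE_I2)
        fix \<omega> assume \<omega>: "\<omega> \<in> space M"
        have "\<bar>\<phi> \<omega> * inner (v n \<omega>) b\<bar> * \<bar>inner (y n \<omega>) b\<bar> \<le> (B * grad_bound n) * norm (y n \<omega>)"
          using coeff[OF \<omega>] Basis_le_norm[OF b, of "y n \<omega>"] B grad_bound_nonneg[of n]
          by (intro mult_mono) auto
        then show "norm (\<phi> \<omega> * inner (v n \<omega>) b * inner (y n \<omega>) b) \<le> norm (B * grad_bound n * norm (y n \<omega>))"
          using B grad_bound_nonneg[of n] by (simp add: abs_mult)
      qed
    qed (simp_all add: norm_y_integrable)
    show "integrable M (\<lambda>\<omega>. (\<phi> \<omega> * inner (v n \<omega>) b) * inner (v n \<omega>) b)"
    proof (rule integrable_bounded_on[where B = "(B * grad_bound n) * grad_bound n"])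
      fix \<omega> assume \<omega>: "\<omega> \<in> space M"
      then show "\<bar>\<phi> \<omega> * inner (v n \<omega>) b * inner (v n \<omega>) b\<bar> \<le> B * grad_bound n * grad_bound n"
        using coeff[OF \<omega>] vb[OF \<omega> b] B grad_bound_nonneg[of n]
        unfolding abs_mult[of "\<phi> \<omega> * inner (v n \<omega>) b"] by (intro mult_mono) auto
    qed simp
    have ae: "AE \<omega> in M. real_cond_exp M (F n) (\<lambda>\<omega>. inner (y n \<omega>) b) \<omega> = inner (v n \<omega>) b"
      using unbiased[of n]
    proof eventually_elim
      case (elim \<omega>)
      have "inner (vec_cond_exp M (F n) (y n) \<omega>) b = real_cond_exp M (F n) (\<lambda>\<omega>. inner (y n \<omega>) b) \<omega>"
        using b unfolding vec_cond_exp_def by (simp add: inner_sum_left inner_Basis if_distrib cong: if_cong)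
      then show ?case using elim by (simp add: v_def)
    qed
    have "(\<integral>\<omega>. (\<phi> \<omega> * inner (v n \<omega>) b) * inner (y n \<omega>) b \<partial>M)
      = (\<integral>\<omega>. (\<phi> \<omega> * inner (v n \<omega>) b) * real_cond_exp M (F n) (\<lambda>\<omega>. inner (y n \<omega>) b) \<omega> \<partial>M)"
      by (rule Fn.real_cond_exp_intg(2)[symmetric, OF i]) measurable
    also have "\<dots> = (\<integral>\<omega>. (\<phi> \<omega> * inner (v n \<omega>) b) * inner (v n \<omega>) b \<partial>M)"
      using ae by (intro integral_cong_AE) auto
    finally show "(\<integral>\<omega>. (\<phi> \<omega> * inner (v n \<omega>) b) * inner (y n \<omega>) b \<partial>M)
      = (\<integral>\<omega>. (\<phi> \<omega> * inner (v n \<omega>) b) * inner (v n \<omega>) b \<partial>M)" .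
  qed
  have expand: "\<phi> \<omega> * ((norm (v n \<omega>))\<^sup>2 - inner (v n \<omega>) (y n \<omega>))
    = (\<Sum>b\<in>Basis. (\<phi> \<omega> * inner (v n \<omega>) b) * inner (v n \<omega>) b - (\<phi> \<omega> * inner (v n \<omega>) b) * inner (y n \<omega>) b)" for \<omega>
  proof -
    have "(norm (v n \<omega>))\<^sup>2 = (\<Sum>b\<in>Basis. inner (v n \<omega>) b * inner (v n \<omega>) b)"
      unfolding power2_norm_eq_inner by (rule euclidean_inner)
    moreover have "inner (v n \<omega>) (y n \<omega>) = (\<Sum>b\<in>Basis. inner (v n \<omega>) b * inner (y n \<omega>) b)"
      by (rule euclidean_inner)
    ultimately show ?thesis
      by (simp add: sum_subtractf sum_distrib_left right_diff_distrib mult.assoc)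
  qed
  show "integrable M (\<lambda>\<omega>. \<phi> \<omega> * ((norm (v n \<omega>))\<^sup>2 - inner (v n \<omega>) (y n \<omega>)))"
    unfolding expand using int int' by (intro Bochner_Integration.integrable_sum Bochner_Integration.integrable_diff)
  show "(\<integral>\<omega>. \<phi> \<omega> * ((norm (v n \<omega>))\<^sup>2 - inner (v n \<omega>) (y n \<omega>)) \<partial>M) = 0"
    unfolding expand using int int' eq by simp
qed

section \<open>Second moment of the normalised gradient sum\<close>

text \<open>
  The constant \<open>K (ln (R / s\<^sub>0) + 1) + W\<close> dominates what the sum of the \<open>\<Gamma> i\<close> can take away while
  \<open>s n \<le> R\<close>. The extra \<open>K\<close> covers the one step at which \<open>s\<close> may jump above \<open>R\<close>; there nonnegativity is
  all that is needed.
\<close>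

definition lyapunov :: "real \<Rightarrow> nat \<Rightarrow> 'w \<Rightarrow> real" where
  "lyapunov R n \<omega> = g (x n \<omega>) + c * \<zeta> n \<omega> + \<alpha> / 4 * (\<Sum>i<n. \<zeta> i \<omega>)
     + (K * (ln (R / s\<^sub>0) + 1) + W) - K * (\<Sum>i<n. \<Gamma> i \<omega>)"

definition lyapunov_start :: "real \<Rightarrow> real" where
  "lyapunov_start R = g x\<^sub>0 + c * ((norm (g' x\<^sub>0))\<^sup>2 / sqrt s\<^sub>0) + (K * (ln (R / s\<^sub>0) + 1) + W)"

lemma lyapunov_lower:
  assumes \<omega>: "\<omega> \<in> space M" and R: "s n \<omega> \<le> R"
  shows "g (x n \<omega>) + c * \<zeta> n \<omega> + \<alpha> / 4 * (\<Sum>i<n. \<zeta> i \<omega>) + W \<le> lyapunov R n \<omega>"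
    and "0 \<le> lyapunov R (Suc n) \<omega>"
proof -
  have "s n \<omega> / s\<^sub>0 \<le> R / s\<^sub>0" using R s\<^sub>0_pos by (simp add: divide_right_mono)
  then have "ln (s n \<omega> / s\<^sub>0) \<le> ln (R / s\<^sub>0)"
    using s_pos[OF \<omega>, of n] s\<^sub>0_pos by (intro ln_mono) auto
  then have sum: "(\<Sum>i<n. \<Gamma> i \<omega>) \<le> ln (R / s\<^sub>0)" using sum_\<Gamma>_le_ln[OF \<omega>, of n] by simp
  then have "K * (\<Sum>i<n. \<Gamma> i \<omega>) \<le> K * (ln (R / s\<^sub>0) + 1)"
    using constants_pos by (intro mult_left_mono) auto
  then show "g (x n \<omega>) + c * \<zeta> n \<omega> + \<alpha> / 4 * (\<Sum>i<n. \<zeta> i \<omega>) + W \<le> lyapunov R n \<omega>"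
    by (simp add: lyapunov_def)
  have "(\<Sum>i<Suc n. \<Gamma> i \<omega>) \<le> ln (R / s\<^sub>0) + 1"
    using sum \<Gamma>_bounds(2)[OF \<omega>, of n] by simp
  then have "K * (\<Sum>i<Suc n. \<Gamma> i \<omega>) \<le> K * (ln (R / s\<^sub>0) + 1)"
    using constants_pos by (intro mult_left_mono) auto
  moreover have "0 \<le> c * \<zeta> (Suc n) \<omega>" "0 \<le> \<alpha> / 4 * (\<Sum>i<Suc n. \<zeta> i \<omega>)"
    using constants_pos \<alpha>_pos \<zeta>_nonneg[OF \<omega>]
    by (auto intro!: mult_nonneg_nonneg sum_nonneg simp del: sum.lessThan_Suc)
  ultimately show "0 \<le> lyapunov R (Suc n) \<omega>"
    using nonneg[of "x (Suc n) \<omega>"] constants_pos unfolding lyapunov_def by linarith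
qed

lemma lyapunov_nonneg:
  assumes \<omega>: "\<omega> \<in> space M" and R: "s n \<omega> \<le> R"
  shows "0 \<le> lyapunov R n \<omega>"
proof -
  have "0 \<le> c * \<zeta> n \<omega>" "0 \<le> \<alpha> / 4 * (\<Sum>i<n. \<zeta> i \<omega>)"
    using constants_pos \<alpha>_pos \<zeta>_nonneg[OF \<omega>] by (auto intro!: mult_nonneg_nonneg sum_nonneg)
  then show ?thesis using lyapunov_lower(1)[OF assms] nonneg[of "x n \<omega>"] constants_pos by linarith
qed

lemma lyapunov_square_increment:
  assumes \<omega>: "\<omega> \<in> space M" and R: "s n \<omega> \<le> R"
  shows "(lyapunov R (Suc n) \<omega>)\<^sup>2 \<le> (lyapunov R n \<omega>)\<^sup>2
      + 2 * \<alpha> * (lyapunov R n \<omega> / sqrt (s n \<omega>) * ((norm (v n \<omega>))\<^sup>2 - inner (v n \<omega>) (y n \<omega>)))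
      + \<alpha> / 2 * (lyapunov R n \<omega> * (norm (v n \<omega>))\<^sup>2 / (h n \<omega> * sqrt (s n \<omega>)) * ((norm (y n \<omega>))\<^sup>2 - h n \<omega>))"
  unfolding h_def
proof (rule lyapunov_square_step[where w = "v (Suc n) \<omega>" and ?G0.0 = "g (x n \<omega>)" and ?G1.0 = "g (x (Suc n) \<omega>)"],
    unfold s_Suc[OF \<omega>, symmetric])
  define k where "k = \<alpha> / sqrt (s (Suc n) \<omega>)"
  note pos = s_pos[OF \<omega>, of "Suc n"]
  have step: "x (Suc n) \<omega> = x n \<omega> + (- k) *\<^sub>R y n \<omega>" by (simp add: x_Suc[OF \<omega>] k_def)
  have k2: "k\<^sup>2 = \<alpha>\<^sup>2 / s (Suc n) \<omega>" using pos by (simp add: k_def power_divide)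
  show "s\<^sub>0 \<le> s n \<omega>" by (rule s_ge[OF \<omega>])
  show "(norm (v n \<omega>))\<^sup>2 \<le> 2 * L * g (x n \<omega>)"
    unfolding v_def by (rule nonneg_smooth_imp_gradient_bound[OF gradient Lipschitz nonneg L_pos])
  show "0 \<le> g (x n \<omega>)" by (rule nonneg)
  show "g (x (Suc n) \<omega>) \<le> g (x n \<omega>) - \<alpha> * inner (v n \<omega>) (y n \<omega>) / sqrt (s (Suc n) \<omega>)
      + L / 2 * (\<alpha>\<^sup>2 * (norm (y n \<omega>))\<^sup>2 / s (Suc n) \<omega>)"
    using descent_inequality[OF gradient Lipschitz, of "x n \<omega>" "(- k) *\<^sub>R y n \<omega>"]
    unfolding step[symmetric] by (simp add: power_mult_distrib k2) (simp add: k_def v_def)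
  have "norm (v (Suc n) \<omega>) \<le> norm (v n \<omega>) + norm (v (Suc n) \<omega> - v n \<omega>)"
    by (metis add.commute diff_add_cancel norm_triangle_ineq)
  also have "norm (v (Suc n) \<omega> - v n \<omega>) \<le> L * norm (x (Suc n) \<omega> - x n \<omega>)"
    unfolding v_def by (rule Lipschitz)
  also have "norm (x (Suc n) \<omega> - x n \<omega>) = \<alpha> * norm (y n \<omega>) / sqrt (s (Suc n) \<omega>)"
    unfolding step using pos \<alpha>_pos by (simp add: k_def)
  finally show "norm (v (Suc n) \<omega>) \<le> norm (v n \<omega>) + L * (\<alpha> * norm (y n \<omega>) / sqrt (s (Suc n) \<omega>))"
    by simp
  have "0 \<le> \<alpha> / 4 * (\<Sum>i<n. \<zeta> i \<omega>)"
    using \<alpha>_pos \<zeta>_nonneg[OF \<omega>] by (auto intro!: mult_nonneg_nonneg sum_nonneg)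
  then show "g (x n \<omega>) + c * ((norm (v n \<omega>))\<^sup>2 / sqrt (s n \<omega>)) + W \<le> lyapunov R n \<omega>"
    using lyapunov_lower(1)[OF assms] by (simp add: \<zeta>_def)
  show "lyapunov R (Suc n) \<omega> = lyapunov R n \<omega> + (g (x (Suc n) \<omega>) + c * ((norm (v (Suc n) \<omega>))\<^sup>2 / sqrt (s (Suc n) \<omega>)))
      - (g (x n \<omega>) + c * ((norm (v n \<omega>))\<^sup>2 / sqrt (s n \<omega>)))
      + \<alpha> / 4 * ((norm (v n \<omega>))\<^sup>2 / sqrt (s n \<omega>)) - K * ((norm (y n \<omega>))\<^sup>2 / s (Suc n) \<omega>)"
    unfolding lyapunov_def sum.lessThan_Suc \<zeta>_def[symmetric] \<Gamma>_def[symmetric] by (simp add: algebra_simps)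
  show "0 \<le> lyapunov R (Suc n) \<omega>" by (rule lyapunov_lower(2)[OF assms])
qed

lemma \<zeta>_bound: "\<omega> \<in> space M \<Longrightarrow> \<zeta> n \<omega> \<le> (grad_bound n)\<^sup>2 / sqrt s\<^sub>0"
  unfolding \<zeta>_def using v_sq_bound[of \<omega> n] s_ge[of \<omega> n] s\<^sub>0_pos by (intro frac_le) auto

lemma lyapunov_bounded: "\<exists>B. \<forall>\<omega>\<in>space M. \<bar>lyapunov R n \<omega>\<bar> \<le> B"
proof -
  obtain G where G: "\<And>\<omega>. \<omega> \<in> space M \<Longrightarrow> g (x n \<omega>) \<le> G" using g_bounded[of n] by blast
  let ?b = "K * (ln (R / s\<^sub>0) + 1) + W"
  let ?B = "G + c * ((grad_bound n)\<^sup>2 / sqrt s\<^sub>0) + \<alpha> / 4 * (\<Sum>i<n. (grad_bound i)\<^sup>2 / sqrt s\<^sub>0) + \<bar>?b\<bar> + K * real n"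
  have "\<bar>lyapunov R n \<omega>\<bar> \<le> ?B" if \<omega>: "\<omega> \<in> space M" for \<omega>
  proof -
    have "c * \<zeta> n \<omega> \<le> c * ((grad_bound n)\<^sup>2 / sqrt s\<^sub>0)"
      using constants_pos \<zeta>_bound[OF \<omega>, of n] by (intro mult_left_mono) auto
    moreover have "\<alpha> / 4 * (\<Sum>i<n. \<zeta> i \<omega>) \<le> \<alpha> / 4 * (\<Sum>i<n. (grad_bound i)\<^sup>2 / sqrt s\<^sub>0)"
      using \<alpha>_pos \<zeta>_bound[OF \<omega>] by (intro mult_left_mono sum_mono) auto
    moreover have "(\<Sum>i<n. \<Gamma> i \<omega>) \<le> (\<Sum>i<n. 1)" by (intro sum_mono \<Gamma>_bounds(2)[OF \<omega>])
    then have "K * (\<Sum>i<n. \<Gamma> i \<omega>) \<le> K * real n" using constants_pos by (intro mult_left_mono) auto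
    moreover have "0 \<le> c * \<zeta> n \<omega>" "0 \<le> \<alpha> / 4 * (\<Sum>i<n. \<zeta> i \<omega>)" "0 \<le> K * (\<Sum>i<n. \<Gamma> i \<omega>)"
      using constants_pos \<alpha>_pos \<zeta>_nonneg[OF \<omega>] \<Gamma>_bounds(1)[OF \<omega>] by (auto intro!: mult_nonneg_nonneg sum_nonneg)
    ultimately show ?thesis using G[OF \<omega>] nonneg[of "x n \<omega>"] unfolding lyapunov_def by linarith
  qed
  then show ?thesis by blast
qed

lemma lyapunov_adapted: "lyapunov R n \<in> borel_measurable (F n)"
proof -
  have "(\<lambda>\<omega>. \<Sum>i<n. \<zeta> i \<omega>) \<in> borel_measurable (F n)" "(\<lambda>\<omega>. \<Sum>i<n. \<Gamma> i \<omega>) \<in> borel_measurable (F n)"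
    by (intro borel_measurable_sum; use adapted_later[OF \<zeta>_adapted] adapted_later[OF \<Gamma>_adapted] in force)+
  moreover have "(\<lambda>\<omega>. g (x n \<omega>)) \<in> borel_measurable (F n)"
    by (rule measurable_compose[OF x_adapted g_measurable(1)])
  ultimately show ?thesis
    unfolding lyapunov_def[abs_def] using \<zeta>_adapted[of n]
    by (intro borel_measurable_add borel_measurable_diff borel_measurable_times borel_measurable_const)
qed

lemma lyapunov_measurable [measurable]: "lyapunov R n \<in> borel_measurable M"
  using lyapunov_adapted adapted_measurable by blast

text \<open>
  Truncation is by the event \<open>s n \<le> R\<close>, which is known before the sample \<open>y n\<close> is drawn. In the
  transition from \<open>n\<close> to \<open>n + 1\<close> the event shrinks, which only helps because the square is nonnegative.
\<close>

definition truncated_energy :: "real \<Rightarrow> nat \<Rightarrow> real" where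
  "truncated_energy R n = expectation (\<lambda>\<omega>. if s n \<omega> \<le> R then (lyapunov R n \<omega>)\<^sup>2 else 0)"

lemma truncated_square_integrable: "integrable M (\<lambda>\<omega>. if s m \<omega> \<le> R then (lyapunov R n \<omega>)\<^sup>2 else 0)"
proof -
  obtain B where B: "\<And>\<omega>. \<omega> \<in> space M \<Longrightarrow> \<bar>lyapunov R n \<omega>\<bar> \<le> B" using lyapunov_bounded by blast
  show ?thesis
  proof (rule integrable_bounded_on[where B = "B\<^sup>2"])
    fix \<omega> assume "\<omega> \<in> space M"
    from power_mono[OF B[OF this], of 2]
    show "\<bar>if s m \<omega> \<le> R then (lyapunov R n \<omega>)\<^sup>2 else 0\<bar> \<le> B\<^sup>2" by simp
  qed measurable
qed

lemma truncated_energy_Suc_le: "truncated_energy R (Suc n) \<le> truncated_energy R n"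
proof -
  obtain B where B: "\<And>\<omega>. \<omega> \<in> space M \<Longrightarrow> \<bar>lyapunov R n \<omega>\<bar> \<le> B" using lyapunov_bounded by blast
  note [measurable] = lyapunov_adapted[of R n] s_adapted[of n] v_adapted[of n] h_adapted[of n]
  define \<phi> where "\<phi> \<omega> = (if s n \<omega> \<le> R then lyapunov R n \<omega> / sqrt (s n \<omega>) else 0)" for \<omega>
  define \<psi> where "\<psi> \<omega> = (if s n \<omega> \<le> R then lyapunov R n \<omega> * (norm (v n \<omega>))\<^sup>2 / (h n \<omega> * sqrt (s n \<omega>)) else 0)" for \<omega>
  have \<phi>: "\<phi> \<in> borel_measurable (F n)" unfolding \<phi>_def[abs_def] by measurable
  have \<psi>: "\<psi> \<in> borel_measurable (F n)" unfolding \<psi>_def[abs_def] by measurable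
  have \<phi>_bnd: "\<bar>\<phi> \<omega>\<bar> \<le> B / sqrt s\<^sub>0" if \<omega>: "\<omega> \<in> space M" for \<omega>
  proof -
    have "\<bar>lyapunov R n \<omega>\<bar> / sqrt (s n \<omega>) \<le> B / sqrt s\<^sub>0"
      using B[OF \<omega>] s_ge[OF \<omega>, of n] s\<^sub>0_pos by (intro frac_le) auto
    moreover have "0 \<le> B / sqrt s\<^sub>0" using B[OF \<omega>] s\<^sub>0_pos by simp
    ultimately show ?thesis using s_pos[OF \<omega>, of n] by (simp add: \<phi>_def)
  qed
  have \<psi>_bnd: "0 \<le> \<psi> \<omega> \<and> \<psi> \<omega> \<le> B * (grad_bound n)\<^sup>2 / (1 * sqrt s\<^sub>0)" if \<omega>: "\<omega> \<in> space M" for \<omega>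
  proof (cases "s n \<omega> \<le> R")
    case True
    have B0: "0 \<le> B" using B[OF \<omega>] by simp
    have "lyapunov R n \<omega> * (norm (v n \<omega>))\<^sup>2 \<le> B * (grad_bound n)\<^sup>2"
      using B[OF \<omega>] v_sq_bound[OF \<omega>, of n] B0 by (intro mult_mono) auto
    moreover have "1 * sqrt s\<^sub>0 \<le> h n \<omega> * sqrt (s n \<omega>)"
      using h_ge[of n \<omega>] s_ge[OF \<omega>, of n] s\<^sub>0_pos by (intro mult_mono) auto
    ultimately have "lyapunov R n \<omega> * (norm (v n \<omega>))\<^sup>2 / (h n \<omega> * sqrt (s n \<omega>)) \<le> B * (grad_bound n)\<^sup>2 / (1 * sqrt s\<^sub>0)"
      using B0 s\<^sub>0_pos by (intro frac_le) auto
    then show ?thesis using True lyapunov_nonneg[OF \<omega> True] h_nonneg[of n \<omega>] s_pos[OF \<omega>, of n] by (simp add: \<psi>_def)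
  next
    case False
    have "0 \<le> B" using B[OF \<omega>] by simp
    then show ?thesis using False s\<^sub>0_pos by (simp add: \<psi>_def)
  qed
  note u = unbiased_pairing[OF \<phi> \<phi>_bnd] and w = variance_pairing[OF \<psi> \<psi>_bnd]
  let ?f = "\<lambda>\<omega>. (if s n \<omega> \<le> R then (lyapunov R n \<omega>)\<^sup>2 else 0)
      + 2 * \<alpha> * (\<phi> \<omega> * ((norm (v n \<omega>))\<^sup>2 - inner (v n \<omega>) (y n \<omega>)))
      + \<alpha> / 2 * (\<psi> \<omega> * ((norm (y n \<omega>))\<^sup>2 - h n \<omega>))"
  have "truncated_energy R (Suc n) \<le> expectation ?f"
    unfolding truncated_energy_def
  proof (rule integral_mono)
    show "integrable M ?f"
      by (intro Bochner_Integration.integrable_add integrable_mult_right truncated_square_integrable u(1) w(1))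
    fix \<omega> assume \<omega>: "\<omega> \<in> space M"
    show "(if s (Suc n) \<omega> \<le> R then (lyapunov R (Suc n) \<omega>)\<^sup>2 else 0) \<le> ?f \<omega>"
    proof (cases "s n \<omega> \<le> R")
      case True
      have "(if s (Suc n) \<omega> \<le> R then (lyapunov R (Suc n) \<omega>)\<^sup>2 else 0) \<le> (lyapunov R (Suc n) \<omega>)\<^sup>2" by simp
      also have "\<dots> \<le> ?f \<omega>" using lyapunov_square_increment[OF \<omega> True] True by (simp add: \<phi>_def \<psi>_def)
      finally show ?thesis .
    next
      case False
      then show ?thesis using s_Suc_le[OF \<omega>, of n] by (simp add: \<phi>_def \<psi>_def)
    qed
  qed (rule truncated_square_integrable)
  also have "expectation ?f = truncated_energy R n + 2 * \<alpha> * 0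
      + \<alpha> / 2 * expectation (\<lambda>\<omega>. \<psi> \<omega> * ((norm (y n \<omega>))\<^sup>2 - h n \<omega>))"
    using u w(1) truncated_square_integrable[of n R n]
    by (subst Bochner_Integration.integral_add; (subst Bochner_Integration.integral_add)?)
      (auto simp: truncated_energy_def intro!: Bochner_Integration.integrable_add integrable_mult_right)
  also have "\<dots> \<le> truncated_energy R n" using w(2) \<alpha>_pos by (simp add: mult_nonneg_nonpos)
  finally show ?thesis .
qed

lemma truncated_second_moment:
  "expectation (\<lambda>\<omega>. if s n \<omega> \<le> R then (\<Sum>i<n. \<zeta> i \<omega>)\<^sup>2 else 0) \<le> 16 / \<alpha>\<^sup>2 * (lyapunov_start R)\<^sup>2"
    (is "expectation ?Y \<le> _")
  and truncated_second_moment_integrable: "integrable M (\<lambda>\<omega>. if s n \<omega> \<le> R then (\<Sum>i<n. \<zeta> i \<omega>)\<^sup>2 else 0)"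
proof -
  have Y: "0 \<le> ?Y \<omega> \<and> ?Y \<omega> \<le> 16 / \<alpha>\<^sup>2 * (if s n \<omega> \<le> R then (lyapunov R n \<omega>)\<^sup>2 else 0)" if \<omega>: "\<omega> \<in> space M" for \<omega>
  proof (cases "s n \<omega> \<le> R")
    case True
    have "0 \<le> c * \<zeta> n \<omega>" "0 \<le> \<alpha> / 4 * (\<Sum>i<n. \<zeta> i \<omega>)"
      using constants_pos \<alpha>_pos \<zeta>_nonneg[OF \<omega>] by (auto intro!: mult_nonneg_nonneg sum_nonneg)
    then have "(\<alpha> / 4 * (\<Sum>i<n. \<zeta> i \<omega>))\<^sup>2 \<le> (lyapunov R n \<omega>)\<^sup>2"
      using lyapunov_lower(1)[OF \<omega> True] nonneg[of "x n \<omega>"] constants_pos by (intro power_mono) linarith+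
    then show ?thesis using True \<alpha>_pos by (simp add: power_mult_distrib field_simps)
  qed simp
  have int: "integrable M (\<lambda>\<omega>. 16 / \<alpha>\<^sup>2 * (if s n \<omega> \<le> R then (lyapunov R n \<omega>)\<^sup>2 else 0))"
    by (intro integrable_mult_right truncated_square_integrable)
  show i: "integrable M ?Y"
  proof (rule Bochner_Integration.integrable_bound[OF int])
    show "AE \<omega> in M. norm (?Y \<omega>) \<le> norm (16 / \<alpha>\<^sup>2 * (if s n \<omega> \<le> R then (lyapunov R n \<omega>)\<^sup>2 else 0))"
      using Y by (intro AE_I2) (smt (verit) real_norm_def)
  qed measurable
  have "expectation ?Y \<le> expectation (\<lambda>\<omega>. 16 / \<alpha>\<^sup>2 * (if s n \<omega> \<le> R then (lyapunov R n \<omega>)\<^sup>2 else 0))"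
    using Y by (intro integral_mono i int) blast
  also have "\<dots> = 16 / \<alpha>\<^sup>2 * truncated_energy R n" unfolding truncated_energy_def by (rule integral_mult_right_zero)
  finally have Y_Q: "expectation ?Y \<le> 16 / \<alpha>\<^sup>2 * truncated_energy R n" .
  have "truncated_energy R n \<le> truncated_energy R 0" by (rule lift_Suc_antimono_le[of "truncated_energy R"]) (auto intro: truncated_energy_Suc_le)
  also have "truncated_energy R 0 \<le> expectation (\<lambda>_. (lyapunov_start R)\<^sup>2)"
    unfolding truncated_energy_def
  proof (intro integral_mono truncated_square_integrable)
    fix \<omega> assume \<omega>: "\<omega> \<in> space M"
    have "lyapunov R 0 \<omega> = lyapunov_start R" by (simp add: lyapunov_def lyapunov_start_def \<zeta>_def v_def x_0[OF \<omega>] s_0[OF \<omega>])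
    then show "(if s 0 \<omega> \<le> R then (lyapunov R 0 \<omega>)\<^sup>2 else 0) \<le> (lyapunov_start R)\<^sup>2" by simp
  qed simp
  also have "\<dots> = (lyapunov_start R)\<^sup>2" by (simp add: prob_space)
  finally have "16 / \<alpha>\<^sup>2 * truncated_energy R n \<le> 16 / \<alpha>\<^sup>2 * (lyapunov_start R)\<^sup>2" by (intro mult_left_mono) auto
  with Y_Q show "expectation ?Y \<le> 16 / \<alpha>\<^sup>2 * (lyapunov_start R)\<^sup>2" by (rule order_trans)
qed

section \<open>Expected sum of squared gradients\<close>

definition grad_sum :: "nat \<Rightarrow> 'w \<Rightarrow> real" where "grad_sum n \<omega> = (\<Sum>i<n. (norm (v i \<omega>))\<^sup>2)"

lemma grad_sum_measurable [measurable]: "grad_sum n \<in> borel_measurable M"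
  unfolding grad_sum_def[abs_def] by measurable

lemma grad_sum_bounds:
  assumes \<omega>: "\<omega> \<in> space M"
  shows "0 \<le> grad_sum n \<omega>" "grad_sum n \<omega> \<le> real n * (grad_bound n)\<^sup>2"
proof -
  show "0 \<le> grad_sum n \<omega>" by (simp add: grad_sum_def sum_nonneg)
  have "(norm (v i \<omega>))\<^sup>2 \<le> (grad_bound n)\<^sup>2" if "i < n" for i
    using v_bound[OF \<omega>, of i] grad_bound_mono[of i n] that by (intro power_mono) auto
  then have "grad_sum n \<omega> \<le> (\<Sum>i<n. (grad_bound n)\<^sup>2)" unfolding grad_sum_def by (intro sum_mono) auto
  then show "grad_sum n \<omega> \<le> real n * (grad_bound n)\<^sup>2" by simp
qed

lemma grad_sum_integrable: "integrable M (grad_sum n)"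
  by (rule integrable_bounded_on[where B = "real n * (grad_bound n)\<^sup>2"]) (use grad_sum_bounds in auto)

lemma expected_denominator:
  shows s_integrable: "integrable M (s n)"
    and "expectation (s n) \<le> s\<^sub>0 + \<sigma>\<^sub>1 * real n + \<sigma>\<^sub>0 * expectation (grad_sum n)"
proof (induction n)
  case 0
  { case 1
    have eq: "integrable M (s 0) \<longleftrightarrow> integrable M (\<lambda>_. s\<^sub>0)"
      by (intro Bochner_Integration.integrable_cong) (auto simp: s_0)
    show ?case unfolding eq by simp
  next
    case 2
    have "expectation (s 0) = expectation (\<lambda>_. s\<^sub>0)" by (intro Bochner_Integration.integral_cong) (auto simp: s_0)
    then show ?case by (simp add: prob_space grad_sum_def[abs_def])
  }
next
  case (Suc n)
  have eq: "integrable M (s (Suc n)) \<longleftrightarrow> integrable M (\<lambda>\<omega>. s n \<omega> + (norm (y n \<omega>))\<^sup>2)"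
    by (intro Bochner_Integration.integrable_cong) (auto simp: s_Suc)
  have hint: "integrable M (\<lambda>\<omega>. \<sigma>\<^sub>0 * (grad_sum (Suc n) \<omega> - grad_sum n \<omega>) + \<sigma>\<^sub>1)"
    using grad_sum_integrable by (intro Bochner_Integration.integrable_add integrable_mult_right Bochner_Integration.integrable_diff) auto
  { case 1
    show ?case unfolding eq using Suc(1) y_sq_integrable by simp
  next
    case 2
    have h: "h n \<omega> = \<sigma>\<^sub>0 * (grad_sum (Suc n) \<omega> - grad_sum n \<omega>) + \<sigma>\<^sub>1" for \<omega> by (simp add: h_def grad_sum_def)
    have "expectation (\<lambda>\<omega>. 1 * ((norm (y n \<omega>))\<^sup>2 - h n \<omega>)) \<le> 0"
      by (rule variance_pairing(2)[where B = 1]) auto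
    then have "expectation (\<lambda>\<omega>. (norm (y n \<omega>))\<^sup>2) \<le> expectation (\<lambda>\<omega>. \<sigma>\<^sub>0 * (grad_sum (Suc n) \<omega> - grad_sum n \<omega>) + \<sigma>\<^sub>1)"
      using y_sq_integrable[of n] hint by (simp add: h)
    also have "\<dots> = \<sigma>\<^sub>0 * (expectation (grad_sum (Suc n)) - expectation (grad_sum n)) + \<sigma>\<^sub>1"
      using grad_sum_integrable by (simp add: prob_space)
    finally have y2: "expectation (\<lambda>\<omega>. (norm (y n \<omega>))\<^sup>2) \<le> \<sigma>\<^sub>0 * (expectation (grad_sum (Suc n)) - expectation (grad_sum n)) + \<sigma>\<^sub>1" .
    have "expectation (s (Suc n)) = expectation (\<lambda>\<omega>. s n \<omega> + (norm (y n \<omega>))\<^sup>2)"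
      by (intro Bochner_Integration.integral_cong) (auto simp: s_Suc)
    also have "\<dots> = expectation (s n) + expectation (\<lambda>\<omega>. (norm (y n \<omega>))\<^sup>2)"
      using Suc(1) y_sq_integrable by simp
    finally show ?case using Suc(2) y2 by (simp add: algebra_simps)
  }
qed

text \<open>
  While \<open>s n \<le> R\<close>, the sum is at most \<open>sqrt (s n)\<close> times the normalised sum, and the weighted
  arithmetic--geometric mean inequality with parameter \<open>\<eta>\<close> applies. Otherwise it has its
  deterministic bound, multiplied by \<open>s n / R > 1\<close> in order to carry the rarity of that event.
\<close>

lemma expected_gradient_sum:
  assumes \<eta>: "\<eta> > 0" and R: "R > 0"
  shows "expectation (grad_sum n) \<le> (\<eta> / 2 + real n * (grad_bound n)\<^sup>2 / R) * expectation (s n)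
      + 8 / (\<alpha>\<^sup>2 * \<eta>) * (lyapunov_start R)\<^sup>2"
proof -
  let ?Y = "\<lambda>\<omega>. if s n \<omega> \<le> R then (\<Sum>i<n. \<zeta> i \<omega>)\<^sup>2 else 0"
  let ?B = "real n * (grad_bound n)\<^sup>2"
  have "grad_sum n \<omega> \<le> (\<eta> / 2 + ?B / R) * s n \<omega> + 1 / (2 * \<eta>) * ?Y \<omega>" if \<omega>: "\<omega> \<in> space M" for \<omega>
  proof (cases "s n \<omega> \<le> R")
    case True
    let ?y = "\<Sum>i<n. \<zeta> i \<omega>" and ?r = "sqrt (s n \<omega>)"
    have "grad_sum n \<omega> \<le> (\<Sum>i<n. ?r * \<zeta> i \<omega>)"
      unfolding grad_sum_def
    proof (rule sum_mono)
      fix i assume "i \<in> {..<n}"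
      then have "sqrt (s i \<omega>) \<le> ?r" using s_mono[OF \<omega>, of i n] by simp
      then have "sqrt (s i \<omega>) * \<zeta> i \<omega> \<le> ?r * \<zeta> i \<omega>" using \<zeta>_nonneg[OF \<omega>] by (intro mult_right_mono)
      then show "(norm (v i \<omega>))\<^sup>2 \<le> ?r * \<zeta> i \<omega>" using s_pos[OF \<omega>, of i] by (simp add: \<zeta>_def)
    qed
    also have "\<dots> = ?r * ?y" by (simp add: sum_distrib_left)
    also have "\<dots> \<le> \<eta> / 2 * s n \<omega> + 1 / (2 * \<eta>) * ?y\<^sup>2"
    proof -
      have "0 \<le> (\<eta> * ?r - ?y)\<^sup>2 / (2 * \<eta>)" using \<eta> by simp
      also have "\<dots> = \<eta> / 2 * ?r\<^sup>2 + 1 / (2 * \<eta>) * ?y\<^sup>2 - ?r * ?y"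
        using \<eta> by (simp add: field_simps power2_eq_square)
      finally show ?thesis using s_pos[OF \<omega>, of n] by simp
    qed
    also have "\<dots> \<le> (\<eta> / 2 + ?B / R) * s n \<omega> + 1 / (2 * \<eta>) * ?Y \<omega>"
      using True R s_pos[OF \<omega>, of n] by (simp add: distrib_right)
    finally show ?thesis .
  next
    case False
    have "grad_sum n \<omega> \<le> ?B * 1" using grad_sum_bounds[OF \<omega>] by simp
    also have "\<dots> \<le> ?B * (s n \<omega> / R)" using False R by (intro mult_left_mono) auto
    also have "\<dots> \<le> (\<eta> / 2 + ?B / R) * s n \<omega>" using \<eta> s_pos[OF \<omega>, of n] by (simp add: distrib_right)
    finally show ?thesis using False by simp
  qed
  then have "expectation (grad_sum n) \<le> expectation (\<lambda>\<omega>. (\<eta> / 2 + ?B / R) * s n \<omega> + 1 / (2 * \<eta>) * ?Y \<omega>)"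
    using s_integrable[of n] truncated_second_moment_integrable[of n R]
    by (intro integral_mono grad_sum_integrable Bochner_Integration.integrable_add integrable_mult_right) auto
  also have "\<dots> = (\<eta> / 2 + ?B / R) * expectation (s n) + 1 / (2 * \<eta>) * expectation ?Y"
    using s_integrable[of n] truncated_second_moment_integrable[of n R]
    by (subst Bochner_Integration.integral_add) (auto intro: integrable_mult_right simp del: integral_mult_right)
  also have "\<dots> \<le> (\<eta> / 2 + ?B / R) * expectation (s n) + 1 / (2 * \<eta>) * (16 / \<alpha>\<^sup>2 * (lyapunov_start R)\<^sup>2)"
    using truncated_second_moment[of n R] \<eta> by (intro add_left_mono mult_left_mono) auto
  finally show ?thesis using \<eta> by (simp add: field_simps)
qed

end


text \<open>The threshold \<open>R = n\<^sup>4\<close> is chosen for this limit: \<open>n (B + P n)\<^sup>2\<close> is the deterministic bound of the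
  gradient sum.\<close>

lemma crude_tail_asymptotics:
  fixes B P :: real
  assumes "P > 0"
  shows "(\<lambda>n. real n * (B + P * real n)\<^sup>2 / real n ^ 4) \<longlonglongrightarrow> 0"
  using assms by real_asymp

text \<open>\<open>Z\<close> is the starting value of the Lyapunov process for the threshold \<open>n\<^sup>4\<close>, and \<open>S\<close> the resulting
  bound on the expected accumulator.\<close>

lemma rate_asymptotics:
  fixes A B K P W \<alpha> \<sigma>\<^sub>0 \<sigma>\<^sub>1 s\<^sub>0 :: real
  assumes "K > 0" "P > 0" "\<alpha> > 0" "\<sigma>\<^sub>0 \<ge> 1" "\<sigma>\<^sub>1 \<ge> 1" "s\<^sub>0 > 0"
  defines "Z \<equiv> \<lambda>n::nat. A + (K * (ln (real n ^ 4 / s\<^sub>0) + 1) + W)"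
  defines "S \<equiv> \<lambda>n::nat. 2 * (s\<^sub>0 + \<sigma>\<^sub>1 * real n + 16 * \<sigma>\<^sub>0\<^sup>2 / \<alpha>\<^sup>2 * (Z n)\<^sup>2)"
  shows "(\<lambda>n. (ln (real n) / sqrt (real n) / 2 + real n * (B + P * real n)\<^sup>2 / real n ^ 4) * S n
      + 8 / (\<alpha>\<^sup>2 * (ln (real n) / sqrt (real n))) * (Z n)\<^sup>2)
      \<in> O(\<lambda>n. sqrt (real n) * ln (real n))"
proof -
  have Z: "Z \<in> O(\<lambda>n. ln (real n))"
    unfolding Z_def using assms(1-6) by real_asymp
  have Z2: "(\<lambda>n. (Z n)\<^sup>2) \<in> O(\<lambda>n. (ln (real n))\<^sup>2)"
    by (rule landau_o.big_power[OF Z])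
  have "(\<lambda>n. (ln (real n))\<^sup>2) \<in> O(\<lambda>n. real n)" by real_asymp
  note Z2n = landau_o.big_trans[OF Z2 this]
  have "(\<lambda>n. s\<^sub>0 + \<sigma>\<^sub>1 * real n) \<in> O(\<lambda>n. real n)" using assms(1-6) by real_asymp
  moreover have "(\<lambda>n. 16 * \<sigma>\<^sub>0\<^sup>2 / \<alpha>\<^sup>2 * (Z n)\<^sup>2) \<in> O(\<lambda>n. real n)"
    using Z2n assms(1-6) by (subst landau_o.big.cmult_in_iff) auto
  ultimately have "(\<lambda>n. (s\<^sub>0 + \<sigma>\<^sub>1 * real n) + 16 * \<sigma>\<^sub>0\<^sup>2 / \<alpha>\<^sup>2 * (Z n)\<^sup>2) \<in> O(\<lambda>n. real n)"
    by (rule sum_in_bigo)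
  then have S: "S \<in> O(\<lambda>n. real n)" unfolding S_def by (subst landau_o.big.cmult_in_iff) auto
  have "(\<lambda>n. ln (real n) / sqrt (real n) / 2 + real n * (B + P * real n)\<^sup>2 / real n ^ 4)
      \<in> O(\<lambda>n. ln (real n) / sqrt (real n))"
    using assms(1-6) by real_asymp
  from landau_o.big.mult[OF this S]
  have 1: "(\<lambda>n. (ln (real n) / sqrt (real n) / 2 + real n * (B + P * real n)\<^sup>2 / real n ^ 4) * S n)
      \<in> O(\<lambda>n. ln (real n) / sqrt (real n) * real n)" .
  have "(\<lambda>n. ln (real n) / sqrt (real n) * real n) \<in> O(\<lambda>n. sqrt (real n) * ln (real n))" by real_asymp
  note 1 = landau_o.big_trans[OF 1 this]
  have "(\<lambda>n. 8 / (\<alpha>\<^sup>2 * (ln (real n) / sqrt (real n)))) \<in> O(\<lambda>n. sqrt (real n) / ln (real n))"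
    using assms(1-6) by real_asymp
  from landau_o.big.mult[OF this Z2]
  have 2: "(\<lambda>n. 8 / (\<alpha>\<^sup>2 * (ln (real n) / sqrt (real n))) * (Z n)\<^sup>2)
      \<in> O(\<lambda>n. sqrt (real n) / ln (real n) * (ln (real n))\<^sup>2)" .
  have "(\<lambda>n. sqrt (real n) / ln (real n) * (ln (real n))\<^sup>2) \<in> O(\<lambda>n. sqrt (real n) * ln (real n))"
    by real_asymp
  note 2 = landau_o.big_trans[OF 2 this]
  from 1 2 show "(\<lambda>n. (ln (real n) / sqrt (real n) / 2 + real n * (B + P * real n)\<^sup>2 / real n ^ 4) * S n
      + 8 / (\<alpha>\<^sup>2 * (ln (real n) / sqrt (real n))) * (Z n)\<^sup>2)
      \<in> O(\<lambda>n. sqrt (real n) * ln (real n))" by (rule sum_in_bigo)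
qed

context adagrad_process
begin

theorem expected_gradient_sum_rate:
  "\<exists>C>0. \<forall>\<^sub>F n in sequentially. expectation (grad_sum n) \<le> C * (sqrt (real n) * ln (real n))"
proof -
  define A where "A = g x\<^sub>0 + c * ((norm (g' x\<^sub>0))\<^sup>2 / sqrt s\<^sub>0)"
  define Zn where "Zn n = A + (K * (ln (real n ^ 4 / s\<^sub>0) + 1) + W)" for n :: nat
  define Sn where "Sn n = 2 * (s\<^sub>0 + \<sigma>\<^sub>1 * real n + 16 * \<sigma>\<^sub>0\<^sup>2 / \<alpha>\<^sup>2 * (Zn n)\<^sup>2)" for n :: nat
  define f where "f n = (ln (real n) / sqrt (real n) / 2 + real n * (grad_bound n)\<^sup>2 / real n ^ 4) * Sn n
      + 8 / (\<alpha>\<^sup>2 * (ln (real n) / sqrt (real n))) * (Zn n)\<^sup>2" for n :: nat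
  have Zn: "lyapunov_start (real n ^ 4) = Zn n" for n by (simp add: lyapunov_start_def Zn_def A_def)
  have "L * \<alpha> > 0" using L_pos \<alpha>_pos by simp
  note asym = rate_asymptotics[OF constants_pos(4) this \<alpha>_pos \<sigma>\<^sub>0_ge \<sigma>\<^sub>1_ge s\<^sub>0_pos,
      where B = "norm (g' x\<^sub>0)" and A = A and W = W, folded grad_bound_def Zn_def, folded Sn_def, folded f_def]
  have f: "f \<in> O(\<lambda>n. sqrt (real n) * ln (real n))" using asym by simp
  have "1 / (4 * \<sigma>\<^sub>0) > 0" using \<sigma>\<^sub>0_ge by simp
  from order_tendstoD(2)[OF crude_tail_asymptotics[OF \<open>L * \<alpha> > 0\<close>, of "norm (g' x\<^sub>0)", folded grad_bound_def] this]
  have small: "\<forall>\<^sub>F n in sequentially. real n * (grad_bound n)\<^sup>2 / real n ^ 4 < 1 / (4 * \<sigma>\<^sub>0)" .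
  have bound: "\<forall>\<^sub>F n in sequentially. expectation (grad_sum n) \<le> f n"
    using small eventually_ge_at_top[of 2]
  proof eventually_elim
    case (elim n)
    have R: "real n ^ 4 > 0" using elim by simp
    let ?E = "expectation (s n)"
    have "AE \<omega> in M. 0 \<le> s n \<omega>" using s_pos[of _ n] by (auto intro!: AE_I2 less_imp_le)
    then have E0: "0 \<le> ?E" by (rule integral_nonneg_AE)
    \<comment> \<open>With \<open>\<eta> = 1 / (2 \<sigma>\<^sub>0)\<close> the gradient sum accounts, up to the square of \<open>Zn\<close>, for at most half
      of the expected accumulator.\<close>
    have "?E \<le> Sn n"
    proof -
      have "expectation (grad_sum n) \<le> (1 / (2 * \<sigma>\<^sub>0) / 2 + real n * (grad_bound n)\<^sup>2 / real n ^ 4) * ?E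
          + 8 / (\<alpha>\<^sup>2 * (1 / (2 * \<sigma>\<^sub>0))) * (Zn n)\<^sup>2"
        unfolding Zn[symmetric] using \<sigma>\<^sub>0_ge by (intro expected_gradient_sum R) simp
      also have "\<dots> \<le> (1 / (2 * \<sigma>\<^sub>0) / 2 + 1 / (4 * \<sigma>\<^sub>0)) * ?E + 8 / (\<alpha>\<^sup>2 * (1 / (2 * \<sigma>\<^sub>0))) * (Zn n)\<^sup>2"
        using elim E0 by (intro add_right_mono mult_right_mono add_left_mono) auto
      also have "\<dots> = 1 / (2 * \<sigma>\<^sub>0) * ?E + 16 * \<sigma>\<^sub>0 / \<alpha>\<^sup>2 * (Zn n)\<^sup>2" using \<sigma>\<^sub>0_ge by (simp add: field_simps)
      finally have "\<sigma>\<^sub>0 * expectation (grad_sum n) \<le> \<sigma>\<^sub>0 * (1 / (2 * \<sigma>\<^sub>0) * ?E + 16 * \<sigma>\<^sub>0 / \<alpha>\<^sup>2 * (Zn n)\<^sup>2)"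
        using \<sigma>\<^sub>0_ge by (intro mult_left_mono) auto
      also have "\<dots> = ?E / 2 + 16 * \<sigma>\<^sub>0\<^sup>2 / \<alpha>\<^sup>2 * (Zn n)\<^sup>2"
        using \<sigma>\<^sub>0_ge by (simp add: field_simps power2_eq_square)
      finally show ?thesis using expected_denominator(2)[of n] unfolding Sn_def by simp
    qed
    have "ln (real n) / sqrt (real n) > 0" using elim by simp
    from expected_gradient_sum[OF this R, of n]
    have "expectation (grad_sum n) \<le> (ln (real n) / sqrt (real n) / 2 + real n * (grad_bound n)\<^sup>2 / real n ^ 4) * ?E
      + 8 / (\<alpha>\<^sup>2 * (ln (real n) / sqrt (real n))) * (Zn n)\<^sup>2" unfolding Zn .
    also have "\<dots> \<le> f n"
      unfolding f_def using \<open>?E \<le> Sn n\<close> elim R by (intro add_right_mono mult_left_mono) auto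
    finally show ?case .
  qed
  from f obtain C where C: "C > 0"
      "\<forall>\<^sub>F n in sequentially. norm (f n) \<le> C * norm (sqrt (real n) * ln (real n))"
    by (rule landau_o.bigE)
  have "\<forall>\<^sub>F n in sequentially. expectation (grad_sum n) \<le> C * (sqrt (real n) * ln (real n))"
    using bound C(2) eventually_ge_at_top[of 1] by eventually_elim (auto simp: abs_mult)
  then show ?thesis using C(1) by blast
qed

end

section \<open>The noise filtration and the high-probability rate\<close>

lemma space_noise_filtration [simp]: "space (noise_filtration M N X \<xi> n) = space M"
  by (auto simp: noise_filtration_def intro!: space_measure_of)

lemma sets_noise_filtration:
  "sets (noise_filtration M N X \<xi> n) = sigma_sets (space M)
     (if n = 0 then {} else {X -` A \<inter> space M | A. A \<in> sets borel} \<union>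
         (\<Union>i\<in>{1..n}. {\<xi> i -` A \<inter> space M | A. A \<in> sets N}))"
  by (auto simp: noise_filtration_def intro!: sets_measure_of)

lemma noise_filtration_mono:
  assumes "m \<le> n"
  shows "subalgebra (noise_filtration M N X \<xi> n) (noise_filtration M N X \<xi> m)"
proof -
  have "(\<Union>i\<in>{1..m}. {\<xi> i -` A \<inter> space M | A. A \<in> sets N})
      \<subseteq> (\<Union>i\<in>{1..n}. {\<xi> i -` A \<inter> space M | A. A \<in> sets N})"
    using assms by (intro UN_mono) auto
  then have "sets (noise_filtration M N X \<xi> m) \<subseteq> sets (noise_filtration M N X \<xi> n)"
    unfolding sets_noise_filtration using assms
    by (intro sigma_sets_mono') (cases "m = 0"; cases "n = 0"; simp; blast)
  then show ?thesis by (simp add: subalgebra_def)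
qed

lemma noise_filtration_subalgebra:
  assumes "X \<in> borel_measurable M" "\<And>i. i \<ge> 1 \<Longrightarrow> \<xi> i \<in> measurable M N"
  shows "subalgebra M (noise_filtration M N X \<xi> n)"
  unfolding subalgebra_def sets_noise_filtration using assms
  by (auto intro!: sets.sigma_sets_subset measurable_sets)

lemma noise_filtration_adapted:
  assumes "1 \<le> i" "i \<le> n" "\<xi> i \<in> measurable M N"
  shows "\<xi> i \<in> measurable (noise_filtration M N X \<xi> n) N"
proof (rule measurableI)
  show "\<xi> i z \<in> space N" if "z \<in> space (noise_filtration M N X \<xi> n)" for z
    using that measurable_space[OF assms(3)] by simp
  show "\<xi> i -` A \<inter> space (noise_filtration M N X \<xi> n) \<in> sets (noise_filtration M N X \<xi> n)"
    if "A \<in> sets N" for A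
    unfolding sets_noise_filtration using that assms by (auto intro!: sigma_sets.Basic)
qed

lemma Min_le_average:
  fixes f :: "nat \<Rightarrow> real"
  assumes "T \<ge> 1"
  shows "Min (f ` {1..T}) \<le> (1 / real T) * (\<Sum>n=1..T. f n)"
proof -
  have "real (card {1..T}) * Min (f ` {1..T}) \<le> (\<Sum>n=1..T. f n)"
    by (rule sum_bounded_below) auto
  then show ?thesis using assms by (simp add: field_simps)
qed

theorem corollary4p2:
  fixes M :: "'w measure"
    and N :: "'x measure"
    and \<xi> :: "nat \<Rightarrow> 'w \<Rightarrow> 'x"
    and g :: "real ^ 'd \<Rightarrow> real"
    and g' :: "real ^ 'd \<Rightarrow> real ^ 'd"
    and G :: "real ^ 'd \<Rightarrow> 'x \<Rightarrow> real ^ 'd"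
    and \<theta> :: "nat \<Rightarrow> 'w \<Rightarrow> real ^ 'd"
    and S :: "nat \<Rightarrow> 'w \<Rightarrow> real"
    and \<theta>\<^sub>1 :: "real ^ 'd"
    and L \<alpha>\<^sub>0 S\<^sub>0 \<sigma>\<^sub>0 \<sigma>\<^sub>1 :: real
  assumes prob: "prob_space M"
    and indep: "prob_space.indep_vars M (\<lambda>_. N) \<xi> {1..}"
    and measurable_G: "(\<lambda>(x, z). G x z) \<in> borel_measurable (borel \<Otimes>\<^sub>M N)"
    and gradient: "\<And>x. GDERIV g x :> g' x"
    and C1: "continuous_on UNIV g'"
    and nonneg: "\<And>x. g x \<ge> 0"
    and Lipschitz: "\<And>x y. norm (g' x - g' y) \<le> L * norm (x - y)"
    and constants: "\<alpha>\<^sub>0 > 0" "S\<^sub>0 > 0" "\<sigma>\<^sub>0 \<ge> 0" "\<sigma>\<^sub>1 \<ge> 0"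
    and iterates: "adagrad_norm M G \<xi> \<alpha>\<^sub>0 S\<^sub>0 \<theta>\<^sub>1 \<theta> S"
    and unbiased: "\<And>n. n \<ge> 1 \<Longrightarrow>
      AE \<omega> in M. vec_cond_exp M (noise_filtration M N (\<theta> 1) \<xi> (n - 1))
                    (\<lambda>\<omega>. G (\<theta> n \<omega>) (\<xi> n \<omega>)) \<omega> = g' (\<theta> n \<omega>)"
    and affine_variance: "\<And>n. n \<ge> 1 \<Longrightarrow>
      AE \<omega> in M. nn_cond_exp M (noise_filtration M N (\<theta> 1) \<xi> (n - 1))
                    (\<lambda>\<omega>. ennreal ((norm (G (\<theta> n \<omega>) (\<xi> n \<omega>)))\<^sup>2)) \<omega>
                  \<le> ennreal (\<sigma>\<^sub>0 * (norm (g' (\<theta> n \<omega>)))\<^sup>2 + \<sigma>\<^sub>1)"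
  shows "\<exists>C > 0. \<forall>\<^sub>F T in sequentially. \<forall>\<delta>. 0 < \<delta> \<and> \<delta> < 1 \<longrightarrow>
    \<P>(\<omega> in M.
        (1 / real T) * (\<Sum>n = 1..T. (norm (g' (\<theta> n \<omega>)))\<^sup>2)
          \<le> C * ((1 / \<delta>) * (ln (real T) / sqrt (real T))) \<and>
        Min ((\<lambda>n. (norm (g' (\<theta> n \<omega>)))\<^sup>2) ` {1..T})
          \<le> C * ((1 / \<delta>) * (ln (real T) / sqrt (real T))))
      \<ge> 1 - \<delta>"
proof -
  interpret prob_space M by (rule prob)
  define F where "F n = noise_filtration M N (\<theta> 1) \<xi> n" for n
  define y where "y n \<omega> = G (\<theta> (Suc n) \<omega>) (\<xi> (Suc n) \<omega>)" for n \<omega>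
  have init: "\<theta> (Suc 0) \<omega> = \<theta>\<^sub>1" "S 0 \<omega> = S\<^sub>0" if "\<omega> \<in> space M" for \<omega>
    using iterates that unfolding adagrad_norm_def by auto
  have step: "S (Suc n) \<omega> = S n \<omega> + (norm (y n \<omega>))\<^sup>2"
      "\<theta> (Suc (Suc n)) \<omega> = \<theta> (Suc n) \<omega> - (\<alpha>\<^sub>0 / sqrt (S (Suc n) \<omega>)) *\<^sub>R y n \<omega>"
    if "\<omega> \<in> space M" for n \<omega>
    using iterates that unfolding adagrad_norm_def y_def
    by (force dest!: bspec[of _ _ \<omega>] spec[of _ "Suc n"])+
  have \<xi>: "\<xi> i \<in> measurable M N" if "i \<ge> 1" for i
    using indep that unfolding indep_vars_def by auto
  have \<theta>1: "\<theta> 1 \<in> borel_measurable M"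
    by (subst measurable_cong[of M _ "\<lambda>_. \<theta>\<^sub>1"]) (auto simp: init)
  have sub: "subalgebra M (F n)" for n
    unfolding F_def using \<theta>1 \<xi> by (rule noise_filtration_subalgebra)
  have filt: "subalgebra (F n) (F m)" if "m \<le> n" for m n
    unfolding F_def using that by (rule noise_filtration_mono)
  have space_F: "space (F n) = space M" for n by (simp add: F_def)
  have y_adapted: "y n \<in> borel_measurable (F (Suc n))" if "\<theta> (Suc n) \<in> borel_measurable (F n)" for n
  proof -
    have 1: "\<theta> (Suc n) \<in> borel_measurable (F (Suc n))"
      by (rule measurable_from_subalg[OF filt that]) simp
    have 2: "\<xi> (Suc n) \<in> measurable (F (Suc n)) N"
      unfolding F_def by (rule noise_filtration_adapted) (auto intro: \<xi>)
    show ?thesis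
      using measurable_compose[OF measurable_Pair[OF 1 2] measurable_G] by (simp add: y_def[abs_def])
  qed
  have adapted: "\<theta> (Suc n) \<in> borel_measurable (F n) \<and> S n \<in> borel_measurable (F n)" for n
  proof (induction n)
    case 0
    have "\<theta> (Suc 0) \<in> borel_measurable (F 0)" "S 0 \<in> borel_measurable (F 0)"
      by (subst measurable_cong[of _ _ "\<lambda>_. \<theta>\<^sub>1"] measurable_cong[of _ _ "\<lambda>_. S\<^sub>0"]; simp add: init space_F)+
    then show ?case ..
  next
    case (Suc n)
    note [measurable] = y_adapted[OF conjunct1[OF Suc]]
      measurable_from_subalg[OF filt[of n "Suc n"] conjunct1[OF Suc], simplified]
      measurable_from_subalg[OF filt[of n "Suc n"] conjunct2[OF Suc], simplified]
    have S: "S (Suc n) \<in> borel_measurable (F (Suc n))"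
      by (subst measurable_cong[of _ _ "\<lambda>\<omega>. S n \<omega> + (norm (y n \<omega>))\<^sup>2"]) (auto simp: step space_F)
    note [measurable] = S
    have "\<theta> (Suc (Suc n)) \<in> borel_measurable (F (Suc n))"
      by (subst measurable_cong[of _ _ "\<lambda>\<omega>. \<theta> (Suc n) \<omega> - (\<alpha>\<^sub>0 / sqrt (S (Suc n) \<omega>)) *\<^sub>R y n \<omega>"])
        (auto simp: step space_F)
    then show ?case using S ..
  qed
  interpret run: adagrad_process \<alpha>\<^sub>0 "max L 1" "\<sigma>\<^sub>0 + 1" "\<sigma>\<^sub>1 + 1" S\<^sub>0 M F g g' "\<lambda>n. \<theta> (Suc n)" y S \<theta>\<^sub>1
  proof unfold_locales
    show "subalgebra M (F n)" for n by (rule sub)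
    show "subalgebra (F n) (F m)" if "m \<le> n" for m n using that by (rule filt)
    show "\<theta> (Suc n) \<in> borel_measurable (F n)" "S n \<in> borel_measurable (F n)" for n
      using adapted by auto
    show "y n \<in> borel_measurable M" for n
      using measurable_from_subalg[OF sub y_adapted] adapted by blast
    show "norm (g' z - g' z') \<le> max L 1 * norm (z - z')" for z z'
      using Lipschitz[of z z'] by (rule order_trans) (intro mult_right_mono; simp)
    show "AE \<omega> in M. vec_cond_exp M (F n) (y n) \<omega> = g' (\<theta> (Suc n) \<omega>)" for n
      using unbiased[of "Suc n"] by (simp add: F_def y_def[abs_def])
    fix n
    have "AE \<omega> in M. nn_cond_exp M (F n) (\<lambda>\<omega>. ennreal ((norm (y n \<omega>))\<^sup>2)) \<omega>
        \<le> ennreal (\<sigma>\<^sub>0 * (norm (g' (\<theta> (Suc n) \<omega>)))\<^sup>2 + \<sigma>\<^sub>1)"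
      using affine_variance[of "Suc n"] by (simp add: F_def y_def)
    then show "AE \<omega> in M. nn_cond_exp M (F n) (\<lambda>\<omega>. ennreal ((norm (y n \<omega>))\<^sup>2)) \<omega>
        \<le> ennreal ((\<sigma>\<^sub>0 + 1) * (norm (g' (\<theta> (Suc n) \<omega>)))\<^sup>2 + (\<sigma>\<^sub>1 + 1))"
    proof eventually_elim
      case (elim \<omega>)
      also have "ennreal (\<sigma>\<^sub>0 * (norm (g' (\<theta> (Suc n) \<omega>)))\<^sup>2 + \<sigma>\<^sub>1)
          \<le> ennreal ((\<sigma>\<^sub>0 + 1) * (norm (g' (\<theta> (Suc n) \<omega>)))\<^sup>2 + (\<sigma>\<^sub>1 + 1))"
        by (intro ennreal_leI) (simp add: distrib_right)
      finally show ?case .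
    qed
  qed (use constants gradient nonneg in \<open>auto simp: init step\<close>)
  obtain C where C: "C > 0"
    "\<forall>\<^sub>F T in sequentially. expectation (run.grad_sum T) \<le> C * (sqrt (real T) * ln (real T))"
    using run.expected_gradient_sum_rate by blast
  have D: "run.grad_sum T \<omega> = (\<Sum>n = 1..T. (norm (g' (\<theta> n \<omega>)))\<^sup>2)" for T \<omega>
    unfolding run.grad_sum_def run.v_def by (simp add: sum.atLeast1_atMost_eq)
  show ?thesis
  proof (intro exI[of _ C] conjI C(1))
    show "\<forall>\<^sub>F T in sequentially. \<forall>\<delta>. 0 < \<delta> \<and> \<delta> < 1 \<longrightarrow>
      \<P>(\<omega> in M.
        (1 / real T) * (\<Sum>n = 1..T. (norm (g' (\<theta> n \<omega>)))\<^sup>2)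
          \<le> C * ((1 / \<delta>) * (ln (real T) / sqrt (real T))) \<and>
        Min ((\<lambda>n. (norm (g' (\<theta> n \<omega>)))\<^sup>2) ` {1..T})
          \<le> C * ((1 / \<delta>) * (ln (real T) / sqrt (real T)))) \<ge> 1 - \<delta>"
      using C(2) eventually_ge_at_top[of 2]
    proof (eventually_elim, intro allI impI)
      fix T :: nat and \<delta> :: real
      assume ED: "expectation (run.grad_sum T) \<le> C * (sqrt (real T) * ln (real T))"
        and T: "T \<ge> 2" and \<delta>: "0 < \<delta> \<and> \<delta> < 1"
      define a where "a = C * (sqrt (real T) * ln (real T)) / \<delta>"
      have a: "a > 0" using T C(1) \<delta> by (simp add: a_def)
      have a_eq: "C * ((1 / \<delta>) * (ln (real T) / sqrt (real T))) = (1 / real T) * a"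
        using T \<delta> by (simp add: a_def field_simps)
      \<comment> \<open>The minimum never exceeds the average, so the second condition is implied by the first.\<close>
      have event: "{\<omega> \<in> space M. (1 / real T) * (\<Sum>n = 1..T. (norm (g' (\<theta> n \<omega>)))\<^sup>2)
          \<le> C * ((1 / \<delta>) * (ln (real T) / sqrt (real T))) \<and>
        Min ((\<lambda>n. (norm (g' (\<theta> n \<omega>)))\<^sup>2) ` {1..T})
          \<le> C * ((1 / \<delta>) * (ln (real T) / sqrt (real T)))} = {\<omega> \<in> space M. run.grad_sum T \<omega> \<le> a}"
      proof -
        have "(1 / real T) * z \<le> (1 / real T) * a \<longleftrightarrow> z \<le> a" for z
          using T by (simp add: divide_le_cancel)
        then show ?thesis
          unfolding a_eq D using Min_le_average[of T] T by (auto intro: order_trans)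
      qed
      have "prob {\<omega> \<in> space M. run.grad_sum T \<omega> \<ge> a} \<le> expectation (run.grad_sum T) / a"
        using a run.grad_sum_bounds(1) by (intro integral_Markov_inequality_measure[where A = "{}"] run.grad_sum_integrable) (auto intro!: AE_I2)
      also have "\<dots> \<le> \<delta> * a / a"
        using ED \<delta> a by (intro divide_right_mono) (auto simp: a_def)
      finally have tail: "prob {\<omega> \<in> space M. run.grad_sum T \<omega> \<ge> a} \<le> \<delta>" using a by simp
      have "1 - prob {\<omega> \<in> space M. run.grad_sum T \<omega> \<le> a} = prob (space M - {\<omega> \<in> space M. run.grad_sum T \<omega> \<le> a})"
        by (rule prob_compl[symmetric]) measurable
      also have "\<dots> \<le> prob {\<omega> \<in> space M. run.grad_sum T \<omega> \<ge> a}"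
        by (intro finite_measure_mono) (auto, measurable)
      finally show "\<P>(\<omega> in M.
        (1 / real T) * (\<Sum>n = 1..T. (norm (g' (\<theta> n \<omega>)))\<^sup>2)
          \<le> C * ((1 / \<delta>) * (ln (real T) / sqrt (real T))) \<and>
        Min ((\<lambda>n. (norm (g' (\<theta> n \<omega>)))\<^sup>2) ` {1..T})
          \<le> C * ((1 / \<delta>) * (ln (real T) / sqrt (real T)))) \<ge> 1 - \<delta>"
        unfolding event using tail by simp
    qed
  qed
qed

end
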